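(* Let $M\subset\mathbb{C}^n$ be a smooth real hypersurface having Levi rank $q$ at $p\in M$, with Levi kernel $K^{10}_p$. Assume that $L\in H^{10}$ is in the Levi kernel up to order $1$ at $p$. Then $L_p\in K^{10}_p$ and $$\tau^3_p(L^2_p,L^1_p,\overline L_p)=0\qquad( * )$$ for all $L^2\in\mathbb{C}T$ and all $L^1\in H^{10}$ with $L^1_p\in K^{10}_p$ (equivalently, $\overline L_p$ is contained in the kernel of $\tau^3_p$ in the last argument). Vice versa, let $L\in H^{10}$ be such that $L_p\in K^{10}_p$ and $( * )$ holds for all such $L^2,L^1$. Let $(\tilde L^1,\ldots,\tilde L^q)$ be a Levi-nondegenerate system of $(1,0)$ vector fields at $p$ (i.e. the matrix $\tau^2_p(\tilde L^j_p,\overline{\tilde L^k_p})$ is nondegenerate) such that $L$ is Levi-orthogonal to each $\tilde L^j$, $j=1,\ldots,q$, in a neighborhood of $p$. Then $L$ is in the Levi kernel up to order $1$ at $p$.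
   Context: Everything is $C^\infty$. $T=TM$; $H\subset T$ is the complex tangent bundle; $Q=T/H$; $\mathbb{C}T,\mathbb{C}H,\mathbb{C}Q$ are complexifications; $\mathbb{C}H=H^{10}\oplus\overline{H^{10}}$ is the decomposition into $(1,0)$ and $(0,1)$ vectors. "$L\in V$" means $L$ is a local section of $V$ near $p$. A contact form is a real $1$-form on $M$ vanishing on $H$; it pairs with $\mathbb{C}Q$ via $\langle\theta,\cdot\rangle$. The Levi form is the bilinear map $\tau^2_p\colon H^{10}_p\times\overline{H^{10}_p}\to\mathbb{C}Q_p$ with $\langle\theta_p,\tau^2_p(L^2_p,L^1_p)\rangle=i\langle\theta,[L^2,L^1]\rangle_p$ for all contact forms $\theta$; the Levi rank is its rank. Levi kernel: $K^{10}_p=\{v\in H^{10}_p:\tau^2_p(v,\bar u)=0\ \forall u\in H^{10}_p\}$. Levi-orthogonality of $(1,0)$ fields $L,\tilde L$ at $x$ means $\tau^2_x(L_x,\overline{\tilde L_x})=0$. $\tau^3_p\colon\mathbb{C}T_p\times K^{10}_p\times\overline{K^{10}_p}\to\mathbb{C}Q_p$ is the tensor given by $\langle\theta_p,\tau^3_p(L^3_p,L^2_p,L^1_p)\rangle=i(L^3\langle\theta,[L^2,L^1]\rangle)_p$ for contact forms $\theta$, $L^3\in\mathbb{C}T$, $L^2,\overline{L^1}\in H^{10}$ with $L^2_p,\overline{L^1_p}\in K^{10}_p$ (it is well defined). A $(1,0)$ vector field $L$ is in the Levi kernel up to order $1$ at $p$ if for all $L^1\in H^{10}$, $L^2\in\mathbb{C}T$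 and all contact forms $\theta$: $\langle\theta,[L^1,\overline L]\rangle_p=(L^2\langle\theta,[L^1,\overline L]\rangle)_p=0$. *)

theory Defs
  imports "HOL-Analysis.Analysis"
begin

section \<open>Smooth functions on subsets of a Euclidean space\<close>

text \<open>Meaningful for open sets \<open>S\<close>. For a finite-dimensional domain this is the usual notion
  of \<open>C\<^sup>k\<close>: all iterated directional derivatives up to order \<open>k\<close> exist and are continuous.\<close>

primrec Ck_on :: "nat \<Rightarrow> 'a::real_normed_vector set \<Rightarrow> ('a \<Rightarrow> 'b::real_normed_vector) \<Rightarrow> bool" where
  "Ck_on 0 S f \<longleftrightarrow> continuous_on S f"
| "Ck_on (Suc k) S f \<longleftrightarrow>
     (\<forall>x\<in>S. f differentiable (at x)) \<and> (\<forall>v. Ck_on k S (\<lambda>x. frechet_derivative f (at x) v))"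

definition smooth_on :: "'a::real_normed_vector set \<Rightarrow> ('a \<Rightarrow> 'b::real_normed_vector) \<Rightarrow> bool" where
  "smooth_on S f \<longleftrightarrow> (\<forall>k. Ck_on k S f)"

text \<open>\<open>F\<close> is a smooth extension to the ambient open set \<open>U \<ni> x\<close> of the function \<open>f\<close>, of which
  only the values on \<open>M\<close> matter.\<close>

definition smooth_ext ::
  "'a::real_normed_vector set \<Rightarrow> 'a \<Rightarrow> ('a \<Rightarrow> 'b::real_normed_vector) \<Rightarrow> 'a set \<Rightarrow> ('a \<Rightarrow> 'b) \<Rightarrow> bool" where
  "smooth_ext M x f U F \<longleftrightarrow> open U \<and> x \<in> U \<and> smooth_on U F \<and> (\<forall>y\<in>M \<inter> U. f y = F y)"

definition smooth_near ::
  "'a::real_normed_vector set \<Rightarrow> 'a \<Rightarrow> ('a \<Rightarrow> 'b::real_normed_vector) \<Rightarrow> bool" where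
  "smooth_near M x f \<longleftrightarrow> (\<exists>U F. smooth_ext M x f U F)"

text \<open>Derivative at \<open>x\<close> of a function on \<open>M\<close> along \<open>v\<close>. For \<open>v\<close> tangent to \<open>M\<close> at \<open>x\<close> it does
  not depend on the extension \<open>F\<close>; it is only used for such \<open>v\<close>.\<close>

definition mderiv ::
  "'a::real_normed_vector set \<Rightarrow> ('a \<Rightarrow> 'b::real_normed_vector) \<Rightarrow> 'a \<Rightarrow> 'a \<Rightarrow> 'b" where
  "mderiv M f x v = (THE d. \<exists>U F. smooth_ext M x f U F \<and> d = frechet_derivative F (at x) v)"


section \<open>Real hypersurfaces and their tangent bundles\<close>

definition defining_fun ::
  "(complex^'n) set \<Rightarrow> complex^'n \<Rightarrow> (complex^'n) set \<Rightarrow> (complex^'n \<Rightarrow> real) \<Rightarrow> bool" where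
  "defining_fun M x U r \<longleftrightarrow> open U \<and> x \<in> U \<and> smooth_on U r \<and> M \<inter> U = {y\<in>U. r y = 0} \<and>
     (\<forall>y\<in>U. \<exists>v. frechet_derivative r (at y) v \<noteq> 0)"

definition real_hypersurface :: "(complex^'n) set \<Rightarrow> bool" where
  "real_hypersurface M \<longleftrightarrow> (\<forall>x\<in>M. \<exists>U r. defining_fun M x U r)"

text \<open>\<open>T\<^sub>x M\<close>: the vectors annihilated by the differentials of all local smooth functions
  vanishing on \<open>M\<close>; see \<open>tangent_space_eq\<close> below for the description as the kernel of \<open>dr\<close>.\<close>

definition tangent_space :: "(complex^'n) set \<Rightarrow> complex^'n \<Rightarrow> (complex^'n) set" where
  "tangent_space M x =
     {v. \<forall>U F. smooth_ext M x (\<lambda>_. 0::real) U F \<longrightarrow> frechet_derivative F (at x) v = 0}"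

definition complex_tangent :: "(complex^'n) set \<Rightarrow> complex^'n \<Rightarrow> (complex^'n) set" where
  "complex_tangent M x = {v \<in> tangent_space M x. \<i> *s v \<in> tangent_space M x}"

lemma smooth_on_differentiable: "smooth_on U f \<Longrightarrow> x \<in> U \<Longrightarrow> f differentiable (at x)"
  unfolding smooth_on_def by (metis Ck_on.simps(2))

lemma vanishing_derivative:
  fixes r F :: "'a::real_normed_vector \<Rightarrow> real"
  assumes r: "(r has_derivative r') (at x)" and F: "(F has_derivative F') (at x)"
    and U: "open U" "x \<in> U" "continuous_on U r"
    and zero: "\<And>y. y \<in> U \<Longrightarrow> r y = 0 \<Longrightarrow> F y = 0"
    and x0: "r x = 0" and w: "r' w > 0" and v: "r' v = 0"
  shows "F' v = 0"
proof -
  interpret r': bounded_linear r' using r by (rule has_derivative_bounded_linear)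
  interpret F': bounded_linear F' using F by (rule has_derivative_bounded_linear)
  have Fx: "F x = 0" using zero U x0 by blast
  define K where "K = \<bar>F' w\<bar> + norm v + norm w"
  have K0: "K \<ge> 0" by (simp add: K_def)
  have main: "\<bar>F' v\<bar> \<le> e * K" if e: "0 < e" "e \<le> 1" for e
  proof -
    define N where "N = norm v + e * norm w + 1"
    have N: "N > 0" using e by (simp add: N_def add_nonneg_pos)
    define c where "c = e * r' w / (2 * N)"
    have c: "c > 0" using e w N by (simp add: c_def)
    obtain d1 where d1: "d1 > 0"
      "\<And>y. norm (y - x) < d1 \<Longrightarrow> norm (r y - r x - r' (y - x)) \<le> c * norm (y - x)"
      using r c unfolding has_derivative_at_alt by blast
    obtain d2 where d2: "d2 > 0"
      "\<And>y. norm (y - x) < d2 \<Longrightarrow> norm (F y - F x - F' (y - x)) \<le> e * norm (y - x)"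
      using F e unfolding has_derivative_at_alt by blast
    obtain d3 where d3: "d3 > 0" "ball x d3 \<subseteq> U"
      using U openE by blast
    define d where "d = min d1 (min d2 d3)"
    have d: "d > 0" using d1(1) d2(1) d3(1) by (simp add: d_def)
    define t where "t = d / (2 * N)"
    have t: "t > 0" using d N by (simp add: t_def)
    have tN: "t * N < d" using d N by (simp add: t_def)
    define g where "g s = x + (t *\<^sub>R v + s *\<^sub>R w)" for s
    have nrm: "norm (g s - x) \<le> t * (norm v + e * norm w)" if "\<bar>s\<bar> \<le> t * e" for s
    proof -
      have "norm (g s - x) \<le> t * norm v + \<bar>s\<bar> * norm w"
        using t norm_triangle_ineq[of "t *\<^sub>R v" "s *\<^sub>R w"] by (simp add: g_def)
      also have "\<dots> \<le> t * norm v + t * e * norm w"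
        using that by (simp add: mult_right_mono)
      finally show ?thesis by (simp add: algebra_simps)
    qed
    have nrm': "norm (g s - x) < t * N" if "\<bar>s\<bar> \<le> t * e" for s
      using nrm[OF that] t by (simp add: N_def algebra_simps)
    have gU: "g s \<in> U" if "\<bar>s\<bar> \<le> t * e" for s
      using nrm'[OF that] tN d3 by (auto simp: d_def dist_norm norm_minus_commute)
    have r'g: "r' (g s - x) = s * r' w" for s
      by (simp add: g_def r'.add r'.scaleR v)
    have est: "\<bar>r (g s) - s * r' w\<bar> < t * e * r' w" if "\<bar>s\<bar> \<le> t * e" for s
    proof -
      have "\<bar>r (g s) - s * r' w\<bar> \<le> c * norm (g s - x)"
        using d1(2)[of "g s"] nrm'[OF that] tN x0 by (simp add: d_def r'g)
      also have "\<dots> \<le> c * (t * N)"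
        using nrm'[OF that] c by (intro mult_left_mono) auto
      also have "\<dots> = t * (e * r' w) / 2" using N by (simp add: c_def)
      also have "\<dots> < t * (e * r' w)" using t e w by simp
      finally show ?thesis by (simp add: mult.assoc)
    qed
    have te: "0 < t * e" using t e by simp
    have lo: "r (g (- (t * e))) \<le> 0" using est[of "- (t * e)"] te by simp
    have hi: "0 \<le> r (g (t * e))" using est[of "t * e"] te by simp
    have cont: "continuous_on {- (t * e)..t * e} (\<lambda>s. r (g s))"
      by (rule continuous_on_compose2[OF U(3)])
         (auto simp: g_def[abs_def] intro!: continuous_intros gU[unfolded g_def])
    have "- (t * e) \<le> t * e" using te by simp
    from IVT'[of "\<lambda>s. r (g s)", OF lo hi this cont]
    obtain s where "- (t * e) \<le> s" "s \<le> t * e" and s2: "r (g s) = 0" by blast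
    then have "\<bar>s\<bar> \<le> t * e" by linarith
    note s = this s2
    have "F (g s) = 0" using zero gU s by blast
    then have "\<bar>F' (g s - x)\<bar> \<le> e * norm (g s - x)"
      using d2(2)[of "g s"] nrm'[OF s(1)] tN Fx by (simp add: d_def)
    also have "\<dots> \<le> e * (t * (norm v + e * norm w))"
      using nrm[OF s(1)] e by (intro mult_left_mono) auto
    finally have "\<bar>t * F' v + s * F' w\<bar> \<le> t * (e * (norm v + e * norm w))"
      by (simp add: g_def F'.add F'.scaleR algebra_simps)
    moreover have "\<bar>s * F' w\<bar> \<le> t * (e * \<bar>F' w\<bar>)"
      using mult_right_mono[OF s(1), of "\<bar>F' w\<bar>"] by (simp add: abs_mult mult.assoc)
    moreover have "\<bar>t * F' v\<bar> = t * \<bar>F' v\<bar>" using t by (simp add: abs_mult)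
    ultimately have "t * \<bar>F' v\<bar> \<le> t * (e * \<bar>F' w\<bar>) + t * (e * (norm v + e * norm w))"
      by linarith
    also have "\<dots> = t * (e * (\<bar>F' w\<bar> + norm v + e * norm w))" by (simp add: algebra_simps)
    finally have "\<bar>F' v\<bar> \<le> e * (\<bar>F' w\<bar> + norm v + e * norm w)"
      using t by simp
    also have "\<dots> \<le> e * K"
      unfolding K_def using e by (intro mult_left_mono add_left_mono) (auto simp: mult_left_le_one_le)
    finally show ?thesis .
  qed
  show ?thesis
  proof (rule ccontr)
    assume "F' v \<noteq> 0"
    define e where "e = min 1 (\<bar>F' v\<bar> / (2 * (K + 1)))"
    have e: "0 < e" "e \<le> 1" using \<open>F' v \<noteq> 0\<close> K0 by (auto simp: e_def)
    have "e * K \<le> \<bar>F' v\<bar> / (2 * (K + 1)) * K"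
      using K0 by (intro mult_right_mono) (auto simp: e_def)
    also have "\<dots> \<le> \<bar>F' v\<bar> / (2 * (K + 1)) * (K + 1)"
      using K0 by (intro mult_left_mono) auto
    also have "\<dots> = \<bar>F' v\<bar> / 2" using K0 by (simp add: field_simps)
    also have "\<dots> < \<bar>F' v\<bar>" using \<open>F' v \<noteq> 0\<close> by simp
    finally show False using main[OF e] by simp
  qed
qed

lemma tangent_space_eq:
  fixes M :: "(complex^'n) set"
  assumes def: "defining_fun M x U r" and x: "x \<in> M"
  shows "tangent_space M x = {v. frechet_derivative r (at x) v = 0}"
proof (intro set_eqI iffI CollectI)
  fix v assume "v \<in> tangent_space M x"
  moreover have "smooth_ext M x (\<lambda>_. 0) U r"
    using def by (auto simp: smooth_ext_def defining_fun_def)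
  ultimately show "frechet_derivative r (at x) v = 0" by (auto simp: tangent_space_def)
next
  fix v assume "v \<in> {v. frechet_derivative r (at x) v = 0}"
  then have v: "frechet_derivative r (at x) v = 0" by simp
  let ?r' = "frechet_derivative r (at x)"
  have U: "open U" "x \<in> U" "smooth_on U r" "M \<inter> U = {y\<in>U. r y = 0}"
    using def by (auto simp: defining_fun_def)
  have r': "(r has_derivative ?r') (at x)"
    using smooth_on_differentiable U frechet_derivative_works by blast
  obtain w0 where w0: "?r' w0 \<noteq> 0" using def U(2) by (auto simp: defining_fun_def)
  have "?r' (- w0) = - ?r' w0"
    by (rule linear_neg[OF has_derivative_linear[OF r']])
  then obtain w where w: "?r' w > 0" using w0 by (metis neg_0_less_iff_less not_less_iff_gr_or_eq)
  have rx: "r x = 0" using U x by blast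
  have "frechet_derivative F (at x) v = 0" if ext: "smooth_ext M x (\<lambda>_. 0::real) V F" for V F
  proof -
    have V: "open V" "x \<in> V" "smooth_on V F" "\<And>y. y \<in> M \<inter> V \<Longrightarrow> F y = 0"
      using ext by (auto simp: smooth_ext_def)
    have F': "(F has_derivative frechet_derivative F (at x)) (at x)"
      using smooth_on_differentiable V frechet_derivative_works by blast
    have cont: "continuous_on (U \<inter> V) r"
      using U(3) smooth_on_differentiable
      by (meson IntD1 continuous_at_imp_continuous_on differentiable_imp_continuous_within)
    show ?thesis
      by (rule vanishing_derivative[OF r' F' _ _ cont _ rx w v]) (use U V in auto)
  qed
  then show "v \<in> tangent_space M x" by (auto simp: tangent_space_def)
qed


section \<open>Complexification\<close>

text \<open>The pair \<open>(v, w)\<close> stands for the element \<open>v + i w\<close> of the complexification of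
  \<open>\<complex>\<^sup>n = \<real>\<^sup>2\<^sup>n\<close>. The scalar \<open>i\<close> acting through \<open>cscale\<close> is therefore
  different from the complex structure \<open>J\<close> of \<open>\<complex>\<^sup>n\<close>, which acts on both components.\<close>

type_synonym 'n cvec = "(complex^'n) \<times> (complex^'n)"

definition cscale :: "complex \<Rightarrow> 'n::finite cvec \<Rightarrow> 'n cvec" where
  "cscale c Z = (Re c *\<^sub>R fst Z - Im c *\<^sub>R snd Z, Re c *\<^sub>R snd Z + Im c *\<^sub>R fst Z)"

definition cconj :: "'n::finite cvec \<Rightarrow> 'n cvec" where
  "cconj Z = (fst Z, - snd Z)"

definition cJ :: "'n::finite cvec \<Rightarrow> 'n cvec" where
  "cJ Z = (\<i> *s fst Z, \<i> *s snd Z)"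

global_interpretation cplx: vector_space "cscale :: complex \<Rightarrow> 'n::finite cvec \<Rightarrow> 'n cvec"
  by unfold_locales (auto simp: cscale_def algebra_simps)

definition CT :: "(complex^'n) set \<Rightarrow> complex^'n \<Rightarrow> 'n cvec set" where
  "CT M x = tangent_space M x \<times> tangent_space M x"

definition CH :: "(complex^'n) set \<Rightarrow> complex^'n \<Rightarrow> 'n cvec set" where
  "CH M x = complex_tangent M x \<times> complex_tangent M x"

definition H10 :: "(complex^'n) set \<Rightarrow> complex^'n \<Rightarrow> 'n cvec set" where
  "H10 M x = {Z \<in> CH M x. cJ Z = cscale \<i> Z}"

definition H01 :: "(complex^'n) set \<Rightarrow> complex^'n \<Rightarrow> 'n cvec set" where
  "H01 M x = cconj ` H10 M x"

text \<open>The fibre \<open>\<complex>Q\<^sub>x = \<complex>T\<^sub>x / \<complex>H\<^sub>x\<close>, consisting of cosets.\<close>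

definition CQ_class :: "(complex^'n) set \<Rightarrow> complex^'n \<Rightarrow> 'n cvec \<Rightarrow> 'n cvec set" where
  "CQ_class M x Z = (\<lambda>Y. Z + Y) ` CH M x"

definition CQ :: "(complex^'n) set \<Rightarrow> complex^'n \<Rightarrow> 'n cvec set set" where
  "CQ M x = CQ_class M x ` CT M x"

abbreviation CQ_zero :: "(complex^'n) set \<Rightarrow> complex^'n \<Rightarrow> 'n cvec set" where
  "CQ_zero M x \<equiv> CQ_class M x 0"


section \<open>Vector fields and contact forms\<close>

text \<open>Sections of \<open>V\<close> over a neighbourhood of \<open>p\<close> in \<open>M\<close>. Fields are total functions whose
  values off this neighbourhood are irrelevant.\<close>

definition local_section ::
  "(complex^'n) set \<Rightarrow> complex^'n \<Rightarrow> (complex^'n \<Rightarrow> 'n cvec set) \<Rightarrow> (complex^'n \<Rightarrow> 'n cvec) \<Rightarrow> bool" where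
  "local_section M p V L \<longleftrightarrow>
     smooth_near M p L \<and> (\<exists>U. open U \<and> p \<in> U \<and> (\<forall>x\<in>M \<inter> U. L x \<in> V x))"

definition conj_field :: "(complex^'n \<Rightarrow> 'n cvec) \<Rightarrow> complex^'n \<Rightarrow> 'n cvec" where
  "conj_field L x = cconj (L x)"

text \<open>\<open>(L f)(x)\<close> for a complexified vector field \<open>L\<close> and a complex function \<open>f\<close>.\<close>

definition apply_field ::
  "(complex^'n) set \<Rightarrow> (complex^'n \<Rightarrow> 'n cvec) \<Rightarrow> (complex^'n \<Rightarrow> complex) \<Rightarrow> complex^'n \<Rightarrow> complex" where
  "apply_field M L f x = mderiv M f x (fst (L x)) + \<i> * mderiv M f x (snd (L x))"

text \<open>Complex bilinear extension of \<open>[X, Y] = D\<^sub>X Y - D\<^sub>Y X\<close>.\<close>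

definition field_deriv ::
  "(complex^'n) set \<Rightarrow> (complex^'n \<Rightarrow> 'n cvec) \<Rightarrow> (complex^'n \<Rightarrow> 'n cvec) \<Rightarrow> complex^'n \<Rightarrow> 'n cvec" where
  "field_deriv M X Y x = mderiv M Y x (fst (X x)) + cscale \<i> (mderiv M Y x (snd (X x)))"

definition bracket ::
  "(complex^'n) set \<Rightarrow> (complex^'n \<Rightarrow> 'n cvec) \<Rightarrow> (complex^'n \<Rightarrow> 'n cvec) \<Rightarrow> complex^'n \<Rightarrow> 'n cvec" where
  "bracket M X Y x = field_deriv M X Y x - field_deriv M Y X x"

text \<open>A real 1-form on \<open>M\<close> is given by a smooth map into the dual of the ambient space, of which
  only the restriction of \<open>\<theta> x\<close> to \<open>T\<^sub>x M\<close> matters. Every smooth 1-form on \<open>M\<close> is of this form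
  (compose with the orthogonal projections onto the tangent spaces).\<close>

definition contact_form ::
  "(complex^'n) set \<Rightarrow> (complex^'n \<Rightarrow> (complex^'n) \<Rightarrow>\<^sub>L real) \<Rightarrow> bool" where
  "contact_form M \<theta> \<longleftrightarrow> (\<forall>x\<in>M. smooth_near M x \<theta>) \<and>
     (\<forall>x\<in>M. \<forall>v\<in>complex_tangent M x. blinfun_apply (\<theta> x) v = 0)"

definition pair_CT :: "((complex^'n) \<Rightarrow>\<^sub>L real) \<Rightarrow> 'n cvec \<Rightarrow> complex" where
  "pair_CT \<alpha> Z = Complex (blinfun_apply \<alpha> (fst Z)) (blinfun_apply \<alpha> (snd Z))"

definition pair_CQ :: "((complex^'n) \<Rightarrow>\<^sub>L real) \<Rightarrow> 'n cvec set \<Rightarrow> complex" where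
  "pair_CQ \<alpha> \<xi> = (THE c. \<forall>Z\<in>\<xi>. pair_CT \<alpha> Z = c)"

definition pair_bracket ::
  "(complex^'n) set \<Rightarrow> (complex^'n \<Rightarrow> (complex^'n) \<Rightarrow>\<^sub>L real) \<Rightarrow>
     (complex^'n \<Rightarrow> 'n cvec) \<Rightarrow> (complex^'n \<Rightarrow> 'n cvec) \<Rightarrow> complex^'n \<Rightarrow> complex" where
  "pair_bracket M \<theta> X Y x = pair_CT (\<theta> x) (bracket M X Y x)"


section \<open>The Levi form and the cubic tensor\<close>

text \<open>The values matter only for \<open>v \<in> H10 M p\<close>, \<open>w \<in> H01 M p\<close>. As there is a contact form
  that does not vanish at \<open>p\<close>, elements of \<open>\<complex>Q\<^sub>p\<close> are determined by their pairings with contact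
  forms.\<close>

definition levi_form :: "(complex^'n) set \<Rightarrow> complex^'n \<Rightarrow> 'n cvec \<Rightarrow> 'n cvec \<Rightarrow> 'n cvec set" where
  "levi_form M p v w = (THE \<xi>. \<xi> \<in> CQ M p \<and>
     (\<forall>\<theta> L2 L1. contact_form M \<theta> \<and>
        local_section M p (H10 M) L2 \<and> local_section M p (H01 M) L1 \<and> L2 p = v \<and> L1 p = w \<longrightarrow>
        pair_CQ (\<theta> p) \<xi> = \<i> * pair_bracket M \<theta> L2 L1 p))"

definition K10 :: "(complex^'n) set \<Rightarrow> complex^'n \<Rightarrow> 'n cvec set" where
  "K10 M p = {v \<in> H10 M p. \<forall>u\<in>H10 M p. levi_form M p v (cconj u) = CQ_zero M p}"

definition K01 :: "(complex^'n) set \<Rightarrow> complex^'n \<Rightarrow> 'n cvec set" where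
  "K01 M p = cconj ` K10 M p"

text \<open>The rank of a bilinear map with values in a line: the codimension of its kernel in the first
  argument.\<close>

definition levi_rank :: "(complex^'n) set \<Rightarrow> complex^'n \<Rightarrow> nat" where
  "levi_rank M p = cplx.dim (H10 M p) - cplx.dim (K10 M p)"

text \<open>The values matter only for \<open>u \<in> CT M p\<close>, \<open>v \<in> K10 M p\<close>, \<open>w \<in> K01 M p\<close>.\<close>

definition tau3 ::
  "(complex^'n) set \<Rightarrow> complex^'n \<Rightarrow> 'n cvec \<Rightarrow> 'n cvec \<Rightarrow> 'n cvec \<Rightarrow> 'n cvec set" where
  "tau3 M p u v w = (THE \<xi>. \<xi> \<in> CQ M p \<and>
     (\<forall>\<theta> L3 L2 L1. contact_form M \<theta> \<and>
        local_section M p (CT M) L3 \<and> local_section M p (H10 M) L2 \<and> local_section M p (H01 M) L1 \<and>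
        L3 p = u \<and> L2 p = v \<and> L1 p = w \<longrightarrow>
        pair_CQ (\<theta> p) \<xi> = \<i> * apply_field M L3 (pair_bracket M \<theta> L2 L1) p))"

definition tau3_kernel :: "(complex^'n) set \<Rightarrow> complex^'n \<Rightarrow> 'n cvec set" where
  "tau3_kernel M p =
     {w \<in> K01 M p. \<forall>u\<in>CT M p. \<forall>v\<in>K10 M p. tau3 M p u v w = CQ_zero M p}"

definition tau3_vanishes :: "(complex^'n) set \<Rightarrow> complex^'n \<Rightarrow> (complex^'n \<Rightarrow> 'n cvec) \<Rightarrow> bool" where
  "tau3_vanishes M p L \<longleftrightarrow>
     (\<forall>L2 L1. local_section M p (CT M) L2 \<and> local_section M p (H10 M) L1 \<and> L1 p \<in> K10 M p \<longrightarrow>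
        tau3 M p (L2 p) (L1 p) (cconj (L p)) = CQ_zero M p)"

definition in_levi_kernel_order1 ::
  "(complex^'n) set \<Rightarrow> complex^'n \<Rightarrow> (complex^'n \<Rightarrow> 'n cvec) \<Rightarrow> bool" where
  "in_levi_kernel_order1 M p L \<longleftrightarrow>
     (\<forall>\<theta> L1 L2. contact_form M \<theta> \<and> local_section M p (H10 M) L1 \<and> local_section M p (CT M) L2 \<longrightarrow>
        pair_bracket M \<theta> L1 (conj_field L) p = 0 \<and>
        apply_field M L2 (pair_bracket M \<theta> L1 (conj_field L)) p = 0)"

definition levi_orthogonal ::
  "(complex^'n) set \<Rightarrow> complex^'n \<Rightarrow> (complex^'n \<Rightarrow> 'n cvec) \<Rightarrow> (complex^'n \<Rightarrow> 'n cvec) \<Rightarrow> bool" where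
  "levi_orthogonal M x L L' \<longleftrightarrow> levi_form M x (L x) (cconj (L' x)) = CQ_zero M x"

text \<open>Nondegeneracy of the matrix with entries \<open>\<tau>\<^sup>2(Lt\<^sub>j, conj Lt\<^sub>k)\<close>: its rows are linearly
  independent. The entries lie in the line \<open>\<complex>Q\<^sub>p\<close>, whose elements are separated by contact
  forms. The range of the indices is \<open>{..<q}\<close>, so \<open>q = 0\<close> is the empty system.\<close>

definition levi_nondegenerate_system ::
  "(complex^'n) set \<Rightarrow> complex^'n \<Rightarrow> nat \<Rightarrow> (nat \<Rightarrow> complex^'n \<Rightarrow> 'n cvec) \<Rightarrow> bool" where
  "levi_nondegenerate_system M p q Lt \<longleftrightarrow>
     (\<forall>j<q. local_section M p (H10 M) (Lt j)) \<and>
     (\<forall>c :: nat \<Rightarrow> complex.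
        (\<forall>k<q. \<forall>\<theta>. contact_form M \<theta> \<longrightarrow>
           (\<Sum>j<q. c j * pair_CQ (\<theta> p) (levi_form M p (Lt j p) (cconj (Lt k p)))) = 0) \<longrightarrow>
        (\<forall>j<q. c j = 0))"

end

theory Submission
  imports Defs
begin

text \<open>
Everything is about the function \<open>\<langle>\<theta>, [X, Y]\<rangle>\<close> for a contact form \<open>\<theta>\<close> and fields \<open>X\<close> of type (1,0)
and \<open>Y\<close> of type (0,1). As \<open>\<theta>\<close> annihilates both fields, Cartan's formula identifies this function with
\<open>- d\<Theta>(X, Y)\<close> for any extension \<open>\<Theta>\<close> of \<open>\<theta>\<close> to the ambient space (\<open>pair_bracket_eq\<close>). It is
therefore a tensor in \<open>X\<close> and \<open>Y\<close>, and its derivatives along \<open>M\<close> obey a product rule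
(\<open>mderiv_pair_bracket\<close>).

Two sections with the same value at \<open>p\<close> differ by a section that vanishes at \<open>p\<close>, and the tangential
derivatives of the latter at \<open>p\<close> are again vectors of type (1,0)
(\<open>mderiv_vanishing_H10_section\<close>). If \<open>X\<^sub>p\<close> and the conjugate of \<open>Y\<^sub>p\<close> lie in the Levi kernel, the
product rule shows that the derivative of the pairing at \<open>p\<close> depends on \<open>X\<^sub>p\<close> and \<open>Y\<^sub>p\<close> only. Moreover
contact forms are proportional to each other near \<open>p\<close>, and the pairing vanishes at \<open>p\<close>, so its
derivative scales with \<open>\<theta>\<^sub>p\<close>. Hence the Levi form and the cubic tensor are well defined, and each
of them vanishes precisely if the pairing, respectively its derivative, vanishes for all contact
forms (\<open>levi_form_zero_iff\<close>, \<open>tau3_zero_iff\<close>). Three existence statements enter: vectors at a point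
extend to sections; some contact form, defined on all of \<open>M\<close>, does not vanish on the tangent space
at the point, for which a smooth cut-off function is needed; and the bracket of tangent fields is
tangent, so that it has a class modulo the complex tangent space, which is the symmetry of the
second derivatives of a defining function.

The first implication and the description by the kernel of the cubic tensor follow, since complex
conjugation exchanges the roles of the two fields (\<open>pair_bracket_conj_swap\<close>). For the converse, let
\<open>X\<close> be any (1,0) field. By the hypothesis on the rank, the given system spans a complement of the
Levi kernel at \<open>p\<close> (\<open>levi_nondegenerate_complement\<close>). So a combination of the system with constant
coefficients can be subtracted from \<open>X\<close> to bring its value at \<open>p\<close> into the Levi kernel. By
orthogonality, all contact forms vanish near \<open>p\<close> on the brackets of the subtracted fields with the
conjugate of \<open>L\<close>; hence \<open>X\<close> may be replaced by the difference, for which the derivative of the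
pairing vanishes at \<open>p\<close> by the hypothesis on the cubic tensor (\<open>in_levi_kernel_order1I\<close>).
\<close>


section \<open>Calculus of smooth functions on open sets\<close>

lemma Ck_on_cong:
  assumes "open S" and "\<And>x. x \<in> S \<Longrightarrow> f x = g x" and "Ck_on k S f"
  shows "Ck_on k S g"
  using assms(2,3)
proof (induction k arbitrary: f g)
  case 0
  then show ?case by (simp cong: continuous_on_cong)
next
  case (Suc k)
  have g': "g differentiable (at x)" "frechet_derivative f (at x) = frechet_derivative g (at x)"
    if x: "x \<in> S" for x
  proof -
    have f: "f differentiable (at x)" using Suc.prems(2) x by simp
    then obtain f' where "(f has_derivative f') (at x)" by (auto simp: differentiable_def)
    from has_derivative_transform_within_open[OF this \<open>open S\<close> x, of g]
    show "g differentiable (at x)" using Suc.prems(1) by (auto simp: differentiable_def)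
    show "frechet_derivative f (at x) = frechet_derivative g (at x)"
      by (rule frechet_derivative_transform_within_open[OF f assms(1) x Suc.prems(1)])
  qed
  have "Ck_on k S (\<lambda>x. frechet_derivative g (at x) v)" for v
    by (rule Suc.IH[of "\<lambda>x. frechet_derivative f (at x) v"]) (use Suc.prems(2) g' in auto)
  with g' show ?case by simp
qed

lemma Ck_on_subset: "Ck_on k S f \<Longrightarrow> T \<subseteq> S \<Longrightarrow> Ck_on k T f"
  by (induction k arbitrary: f) (auto intro: continuous_on_subset)

lemma Ck_on_Suc_imp: "Ck_on (Suc k) S f \<Longrightarrow> Ck_on k S f"
proof (induction k arbitrary: f)
  case 0
  then show ?case
    by (auto intro!: continuous_at_imp_continuous_on differentiable_imp_continuous_within)
next
  case (Suc k)
  then have "Ck_on k S (\<lambda>x. frechet_derivative f (at x) v)" for v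
    by (metis Ck_on.simps(2))
  with Suc.prems show ?case by (metis Ck_on.simps(2))
qed

lemma Ck_on_const: "Ck_on k S (\<lambda>x. c)"
  by (induction k arbitrary: c) auto

lemma Ck_on_ident: "Ck_on k S (\<lambda>x. x)"
  by (cases k) (auto intro: Ck_on_const)

lemma Ck_on_add:
  assumes "open S" "Ck_on k S f" "Ck_on k S g"
  shows "Ck_on k S (\<lambda>x. f x + g x)"
  using assms(2,3)
proof (induction k arbitrary: f g)
  case 0
  then show ?case by (auto intro: continuous_on_add)
next
  case (Suc k)
  have D: "((\<lambda>x. f x + g x) has_derivative
      (\<lambda>v. frechet_derivative f (at x) v + frechet_derivative g (at x) v)) (at x)" if "x \<in> S" for x
    using Suc.prems that
    by (intro has_derivative_add) (auto simp: frechet_derivative_works)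
  have "Ck_on k S (\<lambda>x. frechet_derivative (\<lambda>x. f x + g x) (at x) v)" for v
    by (rule Ck_on_cong[OF \<open>open S\<close> _ Suc.IH])
       (use Suc.prems in \<open>auto simp flip: frechet_derivative_at[OF D]\<close>)
  with D show ?case by (auto simp: differentiable_def)
qed

lemma Ck_on_bilinear:
  assumes b: "bounded_bilinear b" and "open S" "Ck_on k S f" "Ck_on k S g"
  shows "Ck_on k S (\<lambda>x. b (f x) (g x))"
  using assms(3,4)
proof (induction k arbitrary: f g)
  case 0
  then show ?case by (auto intro: bounded_bilinear.continuous_on[OF b])
next
  case (Suc k)
  have D: "((\<lambda>x. b (f x) (g x)) has_derivative
      (\<lambda>v. b (f x) (frechet_derivative g (at x) v) + b (frechet_derivative f (at x) v) (g x))) (at x)"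
    if "x \<in> S" for x
    using Suc.prems that
    by (intro bounded_bilinear.FDERIV[OF b]) (auto simp: frechet_derivative_works)
  have fg: "Ck_on k S f" "Ck_on k S g" using Suc.prems by (auto intro: Ck_on_Suc_imp)
  have "Ck_on k S (\<lambda>x. frechet_derivative (\<lambda>x. b (f x) (g x)) (at x) v)" for v
    by (rule Ck_on_cong[OF \<open>open S\<close> _
          Ck_on_add[OF \<open>open S\<close> Suc.IH[OF fg(1)] Suc.IH[OF _ fg(2)]],
          of "\<lambda>x. frechet_derivative g (at x) v" "\<lambda>x. frechet_derivative f (at x) v"])
       (use Suc.prems in \<open>auto simp flip: frechet_derivative_at[OF D]\<close>)
  with D show ?case by (auto simp: differentiable_def)
qed

lemma smooth_on_cong: "open S \<Longrightarrow> (\<And>x. x \<in> S \<Longrightarrow> f x = g x) \<Longrightarrow> smooth_on S f \<Longrightarrow> smooth_on S g"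
  unfolding smooth_on_def using Ck_on_cong by metis

lemma smooth_on_subset: "smooth_on S f \<Longrightarrow> T \<subseteq> S \<Longrightarrow> smooth_on T f"
  unfolding smooth_on_def using Ck_on_subset by blast

lemma smooth_on_const: "smooth_on S (\<lambda>x. c)"
  by (simp add: smooth_on_def Ck_on_const)

lemma smooth_on_ident: "smooth_on S (\<lambda>x. x)"
  by (simp add: smooth_on_def Ck_on_ident)

lemma smooth_on_add: "open S \<Longrightarrow> smooth_on S f \<Longrightarrow> smooth_on S g \<Longrightarrow> smooth_on S (\<lambda>x. f x + g x)"
  by (simp add: smooth_on_def Ck_on_add)

lemma smooth_on_bilinear:
  "bounded_bilinear b \<Longrightarrow> open S \<Longrightarrow> smooth_on S f \<Longrightarrow> smooth_on S g \<Longrightarrow> smooth_on S (\<lambda>x. b (f x) (g x))"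
  by (simp add: smooth_on_def Ck_on_bilinear)

lemma smooth_on_bounded_linear:
  fixes h :: "'b::real_normed_vector \<Rightarrow> 'c::real_normed_vector"
  assumes h: "bounded_linear h" and S: "open S" and f: "smooth_on S f"
  shows "smooth_on S (\<lambda>x. h (f x))"
proof -
  \<comment> \<open>A bounded linear map is the bilinear map that multiplies its value by a real scalar,
    with the scalar fixed to one.\<close>
  interpret h: bounded_linear h by (rule h)
  have "bounded_bilinear (\<lambda>(c::real) y. c *\<^sub>R h y)"
    using bounded_bilinear.comp[OF bounded_bilinear_scaleR bounded_linear_ident h] .
  from smooth_on_bilinear[OF this S smooth_on_const[of S 1] f] show ?thesis by simp
qed

lemma smooth_on_diff:
  "open S \<Longrightarrow> smooth_on S f \<Longrightarrow> smooth_on S g \<Longrightarrow> smooth_on S (\<lambda>x. f x - g x)"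
  using smooth_on_add[of S f "\<lambda>x. - g x"]
    smooth_on_bounded_linear[OF bounded_linear_minus[OF bounded_linear_ident], of S g] by simp

lemma smooth_on_sum:
  "open S \<Longrightarrow> (\<And>i. i \<in> I \<Longrightarrow> smooth_on S (f i)) \<Longrightarrow> smooth_on S (\<lambda>x. \<Sum>i\<in>I. f i x)"
  by (induction I rule: infinite_finite_induct) (auto intro: smooth_on_const smooth_on_add)

lemma smooth_on_frechet_derivative:
  "smooth_on S f \<Longrightarrow> smooth_on S (\<lambda>x. frechet_derivative f (at x) v)"
  unfolding smooth_on_def by (metis Ck_on.simps(2))

lemma smooth_on_has_derivative:
  "smooth_on S f \<Longrightarrow> x \<in> S \<Longrightarrow> (f has_derivative frechet_derivative f (at x)) (at x)"
  using smooth_on_differentiable frechet_derivative_works by blast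

lemma smooth_on_compose_real:
  fixes g :: "real \<Rightarrow> real" and h :: "'a::real_normed_vector \<Rightarrow> real"
  assumes "smooth_on UNIV g" "open S" "smooth_on S h"
  shows "smooth_on S (\<lambda>x. g (h x))"
proof -
  have "Ck_on k S (\<lambda>x. g (h x))" for k
    using assms(1)
  proof (induction k arbitrary: g)
    case 0
    have "continuous_on UNIV g" "continuous_on S h"
      using 0 assms(3) unfolding smooth_on_def by (metis Ck_on.simps(1))+
    then show ?case by (auto intro: continuous_on_compose2)
  next
    case (Suc k)
    let ?g' = "\<lambda>t. frechet_derivative g (at t) 1"
    have lin: "frechet_derivative g (at t) s = s * ?g' t" for s t
      using linear_scale[OF linear_frechet_derivative[OF smooth_on_differentiable[OF Suc.prems]],
        of t s 1] by simp
    have D: "((\<lambda>x. g (h x)) has_derivative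
        (\<lambda>v. frechet_derivative h (at x) v * ?g' (h x))) (at x)" if "x \<in> S" for x
      by (rule has_derivative_eq_rhs[OF has_derivative_compose[OF
              smooth_on_has_derivative[OF assms(3) that]
              smooth_on_has_derivative[OF Suc.prems UNIV_I]]])
         (intro ext lin)
    have "Ck_on k S (\<lambda>x. frechet_derivative (\<lambda>x. g (h x)) (at x) v)" for v
      by (rule Ck_on_cong[OF \<open>open S\<close> _ Ck_on_bilinear[OF bounded_bilinear_mult \<open>open S\<close> _
            Suc.IH[OF smooth_on_frechet_derivative[OF Suc.prems]]],
            of "\<lambda>x. frechet_derivative h (at x) v"])
         (use smooth_on_frechet_derivative[OF assms(3)] in
          \<open>auto simp: smooth_on_def simp flip: frechet_derivative_at[OF D]\<close>)
    with D show ?case by (auto simp: differentiable_def)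
  qed
  then show ?thesis by (simp add: smooth_on_def)
qed


section \<open>A smooth cut-off function\<close>

definition exp_flat :: "nat \<Rightarrow> real \<Rightarrow> real" where
  "exp_flat n t = (if t > 0 then exp (- inverse t) * inverse t ^ n else 0)"

lemma exp_flat_tendsto_0: "(exp_flat n \<longlongrightarrow> 0) (at 0)"
proof -
  have "((\<lambda>t. inverse t ^ n / exp (inverse t)) \<longlongrightarrow> 0) (at_right (0::real))"
    by (rule filterlim_compose[OF tendsto_power_div_exp_0 filterlim_inverse_at_top_right])
  then have "(exp_flat n \<longlongrightarrow> 0) (at_right 0)"
    by (rule Lim_transform_eventually)
       (auto simp: eventually_at_filter exp_flat_def exp_minus field_simps)
  moreover have "(exp_flat n \<longlongrightarrow> 0) (at_left 0)"
    by (rule tendsto_eventually) (auto simp: eventually_at_filter exp_flat_def)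
  ultimately show ?thesis by (simp add: filterlim_split_at)
qed

text \<open>The family is closed under differentiation, which reduces smoothness to differentiability
  of each member; at the origin the difference quotient of a member is the next member.\<close>

lemma exp_flat_has_derivative:
  "(exp_flat n has_real_derivative exp_flat (n + 2) t - real n * exp_flat (n + 1) t) (at t)"
proof -
  consider "t < 0" | "t = 0" | "t > 0" by linarith
  then show ?thesis
  proof cases
    case 1
    have "(exp_flat n has_real_derivative 0) (at t)"
      by (rule has_field_derivative_transform_within_open[OF DERIV_const, where S = "{..<0}"])
         (use 1 in \<open>auto simp: exp_flat_def\<close>)
    with 1 show ?thesis by (simp add: exp_flat_def)
  next
    case 2
    have "((\<lambda>h. exp_flat n h / h) \<longlongrightarrow> 0) (at 0)"
      by (rule Lim_transform_eventually[OF exp_flat_tendsto_0[of "Suc n"]])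
         (auto simp: eventually_at_filter exp_flat_def field_simps)
    with 2 show ?thesis by (simp add: DERIV_def exp_flat_def)
  next
    case 3
    have "((\<lambda>t. exp (- inverse t) * inverse t ^ n) has_real_derivative
        exp_flat (n + 2) t - real n * exp_flat (n + 1) t) (at t)"
    proof (cases n)
      case 0
      then show ?thesis using 3
        by (auto intro!: derivative_eq_intros simp: exp_flat_def power2_eq_square)
    next
      case (Suc m)
      have "m = 0 \<or> inverse t * inverse t ^ (m - Suc 0) = inverse t ^ m"
        by (cases m) auto
      with Suc show ?thesis using 3
        by (auto intro!: derivative_eq_intros simp: exp_flat_def power2_eq_square algebra_simps)
    qed
    then show ?thesis
      by (rule has_field_derivative_transform_within_open[where S = "{0<..}"])
         (use 3 in \<open>auto simp: exp_flat_def\<close>)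
  qed
qed

lemma smooth_on_exp_flat: "smooth_on UNIV (exp_flat n)"
proof -
  have "Ck_on k UNIV (exp_flat n)" for k
  proof (induction k arbitrary: n)
    case 0
    show ?case
      using DERIV_isCont[OF exp_flat_has_derivative] by (simp add: continuous_at_imp_continuous_on)
  next
    case (Suc k)
    have D: "(exp_flat n has_derivative
        (\<lambda>v. (exp_flat (n + 2) t + (- real n) * exp_flat (n + 1) t) * v)) (at t)" for t
      using exp_flat_has_derivative[of n t] by (simp add: has_field_derivative_def)
    have "Ck_on k UNIV (\<lambda>t. (exp_flat (n + 2) t + (- real n) * exp_flat (n + 1) t) * v)" for v
      by (intro Ck_on_bilinear[OF bounded_bilinear_mult] Ck_on_add Ck_on_const Suc.IH) auto
    then show ?case
      using D unfolding Ck_on.simps frechet_derivative_at[OF D, symmetric]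
      by (auto simp: differentiable_def)
  qed
  then show ?thesis by (simp add: smooth_on_def)
qed


section \<open>Symmetry of second derivatives\<close>

text \<open>Young's argument: the second difference of \<open>f\<close> over the parallelogram spanned by \<open>t u\<close> and
  \<open>t v\<close> is, up to \<open>o(t\<^sup>2)\<close>, equal to \<open>t\<^sup>2\<close> times the derivative along \<open>v\<close> of the derivative
  along \<open>u\<close>. As it is symmetric in \<open>u\<close> and \<open>v\<close>, so is its leading coefficient.\<close>

lemma second_difference_estimate:
  fixes f :: "'a::real_normed_vector \<Rightarrow> real"
  assumes S: "open S" "x \<in> S" "smooth_on S f" and e: "e > 0"
  shows "\<exists>d>0. \<forall>t. 0 < t \<and> t < d \<longrightarrow>
    \<bar>f (x + t *\<^sub>R u + t *\<^sub>R v) - f (x + t *\<^sub>R u) - f (x + t *\<^sub>R v) + f x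
      - t\<^sup>2 * frechet_derivative (\<lambda>y. frechet_derivative f (at y) u) (at x) v\<bar> \<le> e * t\<^sup>2"
proof -
  define g where "g y = frechet_derivative f (at y) u" for y
  define g' where "g' = frechet_derivative g (at x)"
  have g: "(g has_derivative g') (at x)"
    unfolding g'_def g_def
    using smooth_on_has_derivative[OF smooth_on_frechet_derivative[OF S(3)] S(2)] .
  interpret g': bounded_linear g' using g by (rule has_derivative_bounded_linear)
  define N where "N = norm u + norm v + 1"
  have N: "N > 0" by (simp add: N_def add_nonneg_pos)
  \<comment> \<open>Points of the parallelogram are within \<open>t N\<close> of \<open>x\<close>. The first order error of the derivative
    along \<open>u\<close> is used at two such points, so an error rate of \<open>c\<close> adds up to \<open>e t\<close>.\<close>
  define c where "c = e / (2 * N)"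
  have c: "c > 0" using e N by (simp add: c_def)
  obtain d1 where d1: "d1 > 0"
    "\<And>y. norm (y - x) < d1 \<Longrightarrow> norm (g y - g x - g' (y - x)) \<le> c * norm (y - x)"
    using g c unfolding has_derivative_at_alt by blast
  obtain d2 where d2: "d2 > 0" "ball x d2 \<subseteq> S" using S openE by blast
  define d where "d = min d1 d2 / N"
  have d: "d > 0" using d1(1) d2(1) N by (simp add: d_def)
  have "\<bar>f (x + t *\<^sub>R u + t *\<^sub>R v) - f (x + t *\<^sub>R u) - f (x + t *\<^sub>R v) + f x - t\<^sup>2 * g' v\<bar> \<le> e * t\<^sup>2"
    if t: "0 < t" "t < d" for t
  proof -
    define a where "a s b = x + s *\<^sub>R u + b *\<^sub>R v" for s b
    have nrm: "norm (a s b - x) \<le> t * N" if "0 \<le> s" "s \<le> t" "0 \<le> b" "b \<le> t" for s b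
    proof -
      have "norm (a s b - x) \<le> s * norm u + b * norm v"
        using norm_triangle_ineq[of "s *\<^sub>R u" "b *\<^sub>R v"] that by (simp add: a_def)
      also have "\<dots> \<le> t * norm u + t * norm v"
        using that by (intro add_mono mult_right_mono) auto
      also have "\<dots> \<le> t * N" using t by (simp add: N_def algebra_simps)
      finally show ?thesis .
    qed
    have tN: "t * N < d1" "t * N < d2" using t N by (auto simp: d_def field_simps)
    have aS: "a s b \<in> S" if "0 \<le> s" "s \<le> t" "0 \<le> b" "b \<le> t" for s b
      using nrm[OF that] tN d2 by (auto simp: dist_norm norm_minus_commute)
    define \<phi> where "\<phi> s = f (a s t) - f (a s 0)" for s
    have lin: "frechet_derivative f (at y) (s *\<^sub>R u) = s * g y" if "y \<in> S" for y s
      using linear_scale[OF linear_frechet_derivative[OF smooth_on_differentiable[OF S(3) that]]]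
      by (simp add: g_def)
    have Da: "((\<lambda>s. f (a s b)) has_real_derivative g (a s b)) (at s)"
      if "0 \<le> s" "s \<le> t" "0 \<le> b" "b \<le> t" for s b
    proof -
      have "((\<lambda>s. a s b) has_derivative (\<lambda>h. h *\<^sub>R u)) (at s)"
        unfolding a_def by (auto intro!: derivative_eq_intros)
      from has_derivative_compose[OF this smooth_on_has_derivative[OF S(3) aS[OF that]]]
      show ?thesis unfolding has_field_derivative_def
        by (rule has_derivative_eq_rhs) (simp add: lin[OF aS[OF that]] fun_eq_iff)
    qed
    have D\<phi>: "(\<phi> has_real_derivative (g (a s t) - g (a s 0))) (at s)" if "0 \<le> s" "s \<le> t" for s
      unfolding \<phi>_def using that t by (intro DERIV_diff Da) auto
    obtain s where s: "0 < s" "s < t" "\<phi> t - \<phi> 0 = (t - 0) * (g (a s t) - g (a s 0))"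
      using MVT2[OF t(1) D\<phi>] by auto
    have est: "\<bar>g (a s b) - g x - g' (a s b - x)\<bar> \<le> c * (t * N)" if "0 \<le> b" "b \<le> t" for b
    proof -
      have "norm (a s b - x) \<le> t * N" using nrm[of s b] s that by auto
      with d1(2)[of "a s b"] tN c show ?thesis
        by (smt (verit) mult_left_mono real_norm_def)
    qed
    have "g' (a s t - x) - g' (a s 0 - x) = t * g' v"
      by (simp add: a_def g'.add g'.scaleR)
    then have "\<bar>g (a s t) - g (a s 0) - t * g' v\<bar> \<le> 2 * (c * (t * N))"
      using est[of t] est[of 0] t by (simp add: abs_le_iff)
    also have "\<dots> = e * t" using N by (simp add: c_def)
    finally have "t * \<bar>g (a s t) - g (a s 0) - t * g' v\<bar> \<le> t * (e * t)"
      using t by simp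
    moreover have "\<phi> t - \<phi> 0 - t\<^sup>2 * g' v = t * (g (a s t) - g (a s 0) - t * g' v)"
      using s(3) by (simp add: power2_eq_square algebra_simps)
    then have "\<bar>\<phi> t - \<phi> 0 - t\<^sup>2 * g' v\<bar> = t * \<bar>g (a s t) - g (a s 0) - t * g' v\<bar>"
      using t by (simp add: abs_mult)
    moreover have "\<phi> t - \<phi> 0 =
        f (x + t *\<^sub>R u + t *\<^sub>R v) - f (x + t *\<^sub>R u) - f (x + t *\<^sub>R v) + f x"
      by (simp add: \<phi>_def a_def)
    ultimately show ?thesis by (simp add: power2_eq_square mult_ac)
  qed
  with d show ?thesis unfolding g'_def g_def by blast
qed

lemma second_derivative_commute:
  fixes f :: "'a::real_normed_vector \<Rightarrow> real"
  assumes S: "open S" "x \<in> S" "smooth_on S f"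
  shows "frechet_derivative (\<lambda>y. frechet_derivative f (at y) u) (at x) v =
    frechet_derivative (\<lambda>y. frechet_derivative f (at y) v) (at x) u" (is "?A = ?B")
proof (rule ccontr)
  assume ne: "?A \<noteq> ?B"
  define e where "e = \<bar>?A - ?B\<bar> / 3"
  have e: "e > 0" using ne by (simp add: e_def)
  define \<Delta> where "\<Delta> t = f (x + t *\<^sub>R u + t *\<^sub>R v) - f (x + t *\<^sub>R u) - f (x + t *\<^sub>R v) + f x" for t
  obtain d1 where d1: "d1 > 0" "\<And>t. 0 < t \<Longrightarrow> t < d1 \<Longrightarrow> \<bar>\<Delta> t - t\<^sup>2 * ?A\<bar> \<le> e * t\<^sup>2"
    using second_difference_estimate[OF S e, of u v] unfolding \<Delta>_def by blast
  have "\<Delta> t = f (x + t *\<^sub>R v + t *\<^sub>R u) - f (x + t *\<^sub>R v) - f (x + t *\<^sub>R u) + f x" for t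
    by (simp add: \<Delta>_def algebra_simps)
  then obtain d2 where d2: "d2 > 0" "\<And>t. 0 < t \<Longrightarrow> t < d2 \<Longrightarrow> \<bar>\<Delta> t - t\<^sup>2 * ?B\<bar> \<le> e * t\<^sup>2"
    using second_difference_estimate[OF S e, of v u] by metis
  define t where "t = min d1 d2 / 2"
  have t: "0 < t" "t < d1" "t < d2" using d1 d2 by (auto simp: t_def)
  have "\<bar>t\<^sup>2 * ?A - t\<^sup>2 * ?B\<bar> \<le> 2 * e * t\<^sup>2"
    using d1(2)[OF t(1,2)] d2(2)[OF t(1,3)] by linarith
  moreover have "\<bar>t\<^sup>2 * ?A - t\<^sup>2 * ?B\<bar> = t\<^sup>2 * \<bar>?A - ?B\<bar>"
    by (simp add: abs_mult flip: right_diff_distrib)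
  ultimately have "t\<^sup>2 * \<bar>?A - ?B\<bar> \<le> t\<^sup>2 * (2 * e)" by (simp add: mult_ac)
  then have "\<bar>?A - ?B\<bar> \<le> 2 * e" using t by simp
  with e show False by (simp add: e_def)
qed


section \<open>Smoothly varying linear maps\<close>

text \<open>Expanding the argument in the standard basis turns the composite into a finite sum of products of
  scalar functions and values at fixed vectors.\<close>

lemma smooth_linear_family:
  fixes \<Lambda> :: "'a::real_normed_vector \<Rightarrow> 'e::euclidean_space \<Rightarrow> 'b::real_normed_vector"
  assumes U: "open U" and lin: "\<And>y. y \<in> U \<Longrightarrow> linear (\<Lambda> y)"
    and sm: "\<And>b. smooth_on U (\<lambda>y. \<Lambda> y b)" and F: "smooth_on U F"
  shows smooth_on_linear_family: "smooth_on U (\<lambda>y. \<Lambda> y (F y))"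
    and frechet_derivative_linear_family: "x \<in> U \<Longrightarrow> frechet_derivative (\<lambda>y. \<Lambda> y (F y)) (at x) u =
      \<Lambda> x (frechet_derivative F (at x) u) + frechet_derivative (\<lambda>y. \<Lambda> y (F x)) (at x) u"
proof -
  have expand: "\<Lambda> y a = (\<Sum>b\<in>Basis. (a \<bullet> b) *\<^sub>R \<Lambda> y b)" if "y \<in> U" for y a
  proof -
    have "\<Lambda> y a = \<Lambda> y (\<Sum>b\<in>Basis. (a \<bullet> b) *\<^sub>R b)" by (simp add: euclidean_representation)
    also have "\<dots> = (\<Sum>b\<in>Basis. (a \<bullet> b) *\<^sub>R \<Lambda> y b)"
      using lin[OF that] by (simp add: linear_sum linear_scale)
    finally show ?thesis .
  qed
  have smG: "smooth_on U (\<lambda>y. \<Sum>b\<in>Basis. (G y \<bullet> b) *\<^sub>R \<Lambda> y b)" if "smooth_on U G" for G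
    by (intro smooth_on_sum smooth_on_bilinear[OF bounded_bilinear_scaleR] U sm
        smooth_on_bounded_linear[OF bounded_linear_inner_left] that)
  show "smooth_on U (\<lambda>y. \<Lambda> y (F y))"
    by (rule smooth_on_cong[OF U _ smG[OF F]]) (simp add: expand)
  assume x: "x \<in> U"
  have D: "frechet_derivative (\<lambda>y. \<Lambda> y (G y)) (at x) u =
      (\<Sum>b\<in>Basis. (G x \<bullet> b) *\<^sub>R frechet_derivative (\<lambda>y. \<Lambda> y b) (at x) u
        + (frechet_derivative G (at x) u \<bullet> b) *\<^sub>R \<Lambda> x b)" if G: "smooth_on U G" for G
  proof -
    have "((\<lambda>y. \<Sum>b\<in>Basis. (G y \<bullet> b) *\<^sub>R \<Lambda> y b) has_derivative
        (\<lambda>u. \<Sum>b\<in>Basis. (G x \<bullet> b) *\<^sub>R frechet_derivative (\<lambda>y. \<Lambda> y b) (at x) u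
        + (frechet_derivative G (at x) u \<bullet> b) *\<^sub>R \<Lambda> x b)) (at x)"
      by (intro has_derivative_sum has_derivative_scaleR has_derivative_inner_left
          smooth_on_has_derivative[OF G x] smooth_on_has_derivative[OF sm x])
    then have "((\<lambda>y. \<Lambda> y (G y)) has_derivative
        (\<lambda>u. \<Sum>b\<in>Basis. (G x \<bullet> b) *\<^sub>R frechet_derivative (\<lambda>y. \<Lambda> y b) (at x) u
        + (frechet_derivative G (at x) u \<bullet> b) *\<^sub>R \<Lambda> x b)) (at x)"
      by (rule has_derivative_transform_within_open[OF _ U x]) (simp add: expand)
    then show ?thesis by (simp flip: frechet_derivative_at)
  qed
  show "frechet_derivative (\<lambda>y. \<Lambda> y (F y)) (at x) u =
      \<Lambda> x (frechet_derivative F (at x) u) + frechet_derivative (\<lambda>y. \<Lambda> y (F x)) (at x) u"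
    unfolding D[OF F] D[OF smooth_on_const[of U "F x"]] expand[OF x, of "frechet_derivative F (at x) u"]
    by (simp add: sum.distrib)
qed

lemma smooth_bilinear_family:
  fixes \<beta> :: "'a::real_normed_vector \<Rightarrow> 'e::euclidean_space \<Rightarrow> 'f::euclidean_space \<Rightarrow> 'b::real_normed_vector"
  assumes U: "open U"
    and lin1: "\<And>y c. y \<in> U \<Longrightarrow> linear (\<lambda>b. \<beta> y b c)"
    and lin2: "\<And>y b. y \<in> U \<Longrightarrow> linear (\<beta> y b)"
    and sm: "\<And>b c. smooth_on U (\<lambda>y. \<beta> y b c)" and F: "smooth_on U F" and G: "smooth_on U G"
  shows smooth_on_bilinear_family: "smooth_on U (\<lambda>y. \<beta> y (F y) (G y))"
    and frechet_derivative_bilinear_family: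
      "x \<in> U \<Longrightarrow> frechet_derivative (\<lambda>y. \<beta> y (F y) (G y)) (at x) u =
        \<beta> x (frechet_derivative F (at x) u) (G x) + \<beta> x (F x) (frechet_derivative G (at x) u)
        + frechet_derivative (\<lambda>y. \<beta> y (F x) (G x)) (at x) u"
proof -
  have sm': "smooth_on U (\<lambda>y. \<beta> y b (G y))" for b
    by (rule smooth_on_linear_family[OF U lin2 sm G])
  show "smooth_on U (\<lambda>y. \<beta> y (F y) (G y))"
    by (rule smooth_on_linear_family[OF U lin1 sm' F])
  assume x: "x \<in> U"
  show "frechet_derivative (\<lambda>y. \<beta> y (F y) (G y)) (at x) u =
        \<beta> x (frechet_derivative F (at x) u) (G x) + \<beta> x (F x) (frechet_derivative G (at x) u)
        + frechet_derivative (\<lambda>y. \<beta> y (F x) (G x)) (at x) u"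
    using frechet_derivative_linear_family[OF U lin1 sm' F x, of u]
      frechet_derivative_linear_family[OF U lin2 sm G x, of "F x" u] by simp
qed


section \<open>Calculus on a subset of the ambient space\<close>

lemma smooth_extD:
  assumes "smooth_ext M x f U F"
  shows "open U" "x \<in> U" "smooth_on U F" "y \<in> M \<Longrightarrow> y \<in> U \<Longrightarrow> f y = F y"
  using assms by (auto simp: smooth_ext_def)

lemma smooth_ext_subset:
  "smooth_ext M x f U F \<Longrightarrow> open V \<Longrightarrow> y \<in> V \<Longrightarrow> V \<subseteq> U \<Longrightarrow> smooth_ext M y f V F"
  by (auto simp: smooth_ext_def intro: smooth_on_subset)

lemma smooth_ext_nhd: "smooth_ext M x f U F \<Longrightarrow> \<forall>\<^sub>F y in nhds x. y \<in> U"
  by (rule eventually_nhds_in_open) (auto simp: smooth_ext_def)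

lemma smooth_nearE:
  assumes "smooth_near M x f" "\<forall>\<^sub>F y in nhds x. P y"
  obtains U F where "smooth_ext M x f U F" "\<And>y. y \<in> U \<Longrightarrow> P y"
proof -
  obtain U F where U: "smooth_ext M x f U F" using assms(1) by (auto simp: smooth_near_def)
  obtain V where "open V" "x \<in> V" "\<forall>y\<in>V. P y" using assms(2) by (auto simp: eventually_nhds)
  with that[OF smooth_ext_subset[OF U, of "U \<inter> V"]] U show ?thesis
    by (auto simp: smooth_ext_def)
qed

lemma smooth_near_eventually: "smooth_near M x f \<Longrightarrow> \<forall>\<^sub>F y in nhds x. smooth_near M y f"
  unfolding smooth_near_def eventually_nhds smooth_ext_def by blast

lemma smooth_near_smooth_on: "open U \<Longrightarrow> x \<in> U \<Longrightarrow> smooth_on U f \<Longrightarrow> smooth_near M x f"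
  by (auto simp: smooth_near_def smooth_ext_def)

lemma smooth_ext_cong:
  assumes "smooth_ext M x f U F" "\<forall>\<^sub>F y in nhds x. y \<in> M \<longrightarrow> f y = g y"
  shows "\<exists>V \<subseteq> U. smooth_ext M x g V F"
proof -
  obtain V where V: "open V" "x \<in> V" "\<forall>y\<in>V. y \<in> M \<longrightarrow> f y = g y"
    using assms(2) by (auto simp: eventually_nhds)
  have "smooth_ext M x g (U \<inter> V) F"
    using assms(1) V by (auto simp: smooth_ext_def intro: smooth_on_subset)
  then show ?thesis by blast
qed

lemma mderiv_cong:
  assumes "\<forall>\<^sub>F y in nhds x. y \<in> M \<longrightarrow> f y = g y"
  shows "mderiv M f x v = mderiv M g x v"
proof -
  have "\<forall>\<^sub>F y in nhds x. y \<in> M \<longrightarrow> g y = f y"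
    using assms by eventually_elim auto
  then have "(\<exists>U F. smooth_ext M x f U F \<and> d = frechet_derivative F (at x) v) \<longleftrightarrow>
      (\<exists>U F. smooth_ext M x g U F \<and> d = frechet_derivative F (at x) v)" for d
    using assms smooth_ext_cong by metis
  then show ?thesis by (simp add: mderiv_def)
qed

lemma smooth_near_common_domain:
  assumes "smooth_near M x f" "smooth_near M x g"
  obtains U F G where "smooth_ext M x f U F" "smooth_ext M x g U G"
proof -
  obtain U F V G where "smooth_ext M x f U F" "smooth_ext M x g V G"
    using assms by (auto simp: smooth_near_def)
  with smooth_ext_subset[of M x f U F "U \<inter> V" x] smooth_ext_subset[of M x g V G "U \<inter> V" x]
  show ?thesis by (intro that[of "U \<inter> V" F G]) (auto simp: smooth_ext_def)
qed

lemma smooth_ext_bilinear: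
  "bounded_bilinear b \<Longrightarrow> smooth_ext M x f U F \<Longrightarrow> smooth_ext M x g U G \<Longrightarrow>
    smooth_ext M x (\<lambda>y. b (f y) (g y)) U (\<lambda>y. b (F y) (G y))"
  using smooth_on_bilinear[of b U F G] by (simp add: smooth_ext_def)

lemma smooth_ext_add:
  "smooth_ext M x f U F \<Longrightarrow> smooth_ext M x g U G \<Longrightarrow>
    smooth_ext M x (\<lambda>y. f y + g y) U (\<lambda>y. F y + G y)"
  using smooth_on_add[of U F G] by (simp add: smooth_ext_def)

lemma smooth_near_bilinear:
  assumes "bounded_bilinear b" "smooth_near M x f" "smooth_near M x g"
  shows "smooth_near M x (\<lambda>y. b (f y) (g y))"
  by (rule smooth_near_common_domain[OF assms(2,3)])
    (use smooth_ext_bilinear[OF assms(1)] smooth_near_def in blast)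

lemma smooth_near_bounded_linear:
  assumes "bounded_linear h" "smooth_near M x f"
  shows "smooth_near M x (\<lambda>y. h (f y))"
  using assms smooth_on_bounded_linear unfolding smooth_near_def smooth_ext_def by metis

lemma smooth_near_add:
  assumes "smooth_near M x f" "smooth_near M x g"
  shows "smooth_near M x (\<lambda>y. f y + g y)"
  by (rule smooth_near_common_domain[OF assms]) (use smooth_ext_add smooth_near_def in blast)

lemma smooth_near_uminus: "smooth_near M x f \<Longrightarrow> smooth_near M x (\<lambda>y. - f y)"
  using smooth_near_bounded_linear[OF bounded_linear_minus[OF bounded_linear_ident]] .

lemma bounded_linear_Pair_zero:
  "bounded_linear (\<lambda>v. (v, 0))" "bounded_linear (\<lambda>v. (0, v))"
  by (auto intro!: bounded_linear_Pair bounded_linear_ident bounded_linear_zero)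

lemma smooth_near_Pair: "smooth_near M x f \<Longrightarrow> smooth_near M x g \<Longrightarrow> smooth_near M x (\<lambda>y. (f y, g y))"
  using smooth_near_add[OF smooth_near_bounded_linear[OF bounded_linear_Pair_zero(1)]
      smooth_near_bounded_linear[OF bounded_linear_Pair_zero(2)], of M x f g] by simp

lemma smooth_near_diff:
  "smooth_near M x f \<Longrightarrow> smooth_near M x g \<Longrightarrow> smooth_near M x (\<lambda>y. f y - g y)"
  using smooth_near_add[OF _ smooth_near_uminus, of M x f g] by simp

text \<open>Two extensions of a function differ by a function that vanishes on the set; the tangent
  vectors are defined as those that annihilate the differentials of such functions. For vector
  values this is applied to the inner product with the difference of the two derivatives.\<close>

lemma mderiv_eq:
  fixes M :: "(complex^'n) set" and f :: "complex^'n \<Rightarrow> 'b::real_inner"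
  assumes f: "smooth_ext M x f U F" and v: "v \<in> tangent_space M x"
  shows "mderiv M f x v = frechet_derivative F (at x) v"
proof -
  have uniq: "frechet_derivative G (at x) v = frechet_derivative F (at x) v"
    if g: "smooth_ext M x f V G" for V G
  proof -
    let ?d = "frechet_derivative G (at x) v - frechet_derivative F (at x) v"
    let ?h = "\<lambda>y. (G y - F y) \<bullet> ?d"
    have UV: "open (U \<inter> V)" "x \<in> U \<inter> V" "smooth_on (U \<inter> V) G" "smooth_on (U \<inter> V) F"
      using smooth_extD[OF f] smooth_extD[OF g] by (auto intro: smooth_on_subset)
    have D: "(?h has_derivative
        (\<lambda>u. (frechet_derivative G (at x) u - frechet_derivative F (at x) u) \<bullet> ?d)) (at x)"
      by (intro has_derivative_inner_left has_derivative_diff smooth_on_has_derivative[OF _ UV(2)] UV)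
    have "smooth_on (U \<inter> V) ?h"
      by (intro smooth_on_bounded_linear[OF bounded_linear_inner_left] smooth_on_diff UV)
    moreover have "G y = F y" if "y \<in> M \<inter> (U \<inter> V)" for y
      using smooth_extD(4)[OF f, of y] smooth_extD(4)[OF g, of y] that by simp
    ultimately have "smooth_ext M x (\<lambda>_. 0::real) (U \<inter> V) ?h"
      using UV(1,2) by (simp add: smooth_ext_def)
    then have "frechet_derivative ?h (at x) v = 0"
      using v unfolding tangent_space_def by blast
    then have "?d \<bullet> ?d = 0" by (simp flip: frechet_derivative_at[OF D])
    then show ?thesis by simp
  qed
  show ?thesis unfolding mderiv_def
    by (rule the_equality) (use f uniq in blast)+
qed

lemma mderiv_bilinear:
  fixes M :: "(complex^'n) set"
    and b :: "'b::real_inner \<Rightarrow> 'c::real_inner \<Rightarrow> 'd::real_inner"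
  assumes b: "bounded_bilinear b" and fg: "smooth_near M x f" "smooth_near M x g"
    and x: "x \<in> M" and v: "v \<in> tangent_space M x"
  shows "mderiv M (\<lambda>y. b (f y) (g y)) x v = b (f x) (mderiv M g x v) + b (mderiv M f x v) (g x)"
proof -
  obtain U F G where F: "smooth_ext M x f U F" and G: "smooth_ext M x g U G"
    using smooth_near_common_domain[OF fg] .
  note E = smooth_ext_bilinear[OF b F G]
  have D: "((\<lambda>y. b (F y) (G y)) has_derivative (\<lambda>v. b (F x) (frechet_derivative G (at x) v)
      + b (frechet_derivative F (at x) v) (G x))) (at x)"
    using F G by (intro bounded_bilinear.FDERIV[OF b] smooth_on_has_derivative)
      (auto simp: smooth_ext_def)
  show ?thesis
    unfolding mderiv_eq[OF E v] mderiv_eq[OF F v] mderiv_eq[OF G v]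
      frechet_derivative_at[OF D, symmetric]
    using smooth_extD(2,4)[OF F] smooth_extD(2,4)[OF G] x by simp
qed

lemma mderiv_bounded_linear:
  fixes M :: "(complex^'n) set"
    and h :: "'b::real_inner \<Rightarrow> 'c::real_inner"
  assumes h: "bounded_linear h" and f: "smooth_near M x f"
    and v: "v \<in> tangent_space M x"
  shows "mderiv M (\<lambda>y. h (f y)) x v = h (mderiv M f x v)"
proof -
  obtain U F where F: "smooth_ext M x f U F"
    using f by (auto simp: smooth_near_def)
  then have E: "smooth_ext M x (\<lambda>y. h (f y)) U (\<lambda>y. h (F y))"
    using smooth_on_bounded_linear[OF h] by (auto simp: smooth_ext_def)
  have D: "((\<lambda>y. h (F y)) has_derivative (\<lambda>v. h (frechet_derivative F (at x) v))) (at x)"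
    using F by (intro bounded_linear.has_derivative[OF h] smooth_on_has_derivative)
      (auto simp: smooth_ext_def)
  show ?thesis
    unfolding mderiv_eq[OF E v] mderiv_eq[OF F v] frechet_derivative_at[OF D, symmetric] ..
qed

lemma mderiv_add:
  fixes M :: "(complex^'n) set" and f g :: "complex^'n \<Rightarrow> 'b::real_inner"
  assumes fg: "smooth_near M x f" "smooth_near M x g" and v: "v \<in> tangent_space M x"
  shows "mderiv M (\<lambda>y. f y + g y) x v = mderiv M f x v + mderiv M g x v"
proof -
  obtain U F G where F: "smooth_ext M x f U F" and G: "smooth_ext M x g U G"
    using smooth_near_common_domain[OF fg] .
  note E = smooth_ext_add[OF F G]
  have D: "((\<lambda>y. F y + G y) has_derivative (\<lambda>v. frechet_derivative F (at x) v
      + frechet_derivative G (at x) v)) (at x)"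
    using F G by (intro has_derivative_add smooth_on_has_derivative) (auto simp: smooth_ext_def)
  show ?thesis
    unfolding mderiv_eq[OF E v] mderiv_eq[OF F v] mderiv_eq[OF G v]
      frechet_derivative_at[OF D, symmetric] ..
qed

lemma mderiv_uminus:
  fixes M :: "(complex^'n) set" and f :: "complex^'n \<Rightarrow> 'b::real_inner"
  assumes "smooth_near M x f" and "v \<in> tangent_space M x"
  shows "mderiv M (\<lambda>y. - f y) x v = - mderiv M f x v"
  using mderiv_bounded_linear[OF bounded_linear_minus[OF bounded_linear_ident] assms] .

lemma mderiv_diff:
  fixes M :: "(complex^'n) set" and f g :: "complex^'n \<Rightarrow> 'b::real_inner"
  assumes "smooth_near M x f" "smooth_near M x g" "v \<in> tangent_space M x"
  shows "mderiv M (\<lambda>y. f y - g y) x v = mderiv M f x v - mderiv M g x v"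
  using mderiv_add[OF assms(1) smooth_near_uminus[OF assms(2)] assms(3)]
    mderiv_uminus[OF assms(2,3)] by simp

lemma mderiv_const:
  fixes M :: "(complex^'n) set" and c :: "'b::real_inner"
  assumes "v \<in> tangent_space M x"
  shows "mderiv M (\<lambda>y. c) x v = 0"
  using mderiv_eq[of M x "\<lambda>_. c" UNIV "\<lambda>_. c" v] assms
  by (simp add: smooth_ext_def smooth_on_const)


section \<open>Algebra of the complexification\<close>

lemma bounded_linear_cJ: "bounded_linear (cJ :: 'n::finite cvec \<Rightarrow> 'n cvec)"
  unfolding linear_conv_bounded_linear[symmetric]
  by (rule linearI) (auto simp: cJ_def vec_eq_iff algebra_simps scaleR_conv_of_real)

lemma bounded_linear_cscale: "bounded_linear (cscale c :: 'n::finite cvec \<Rightarrow> 'n cvec)"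
  unfolding linear_conv_bounded_linear[symmetric]
  by (rule linearI) (auto simp: cscale_def algebra_simps)

lemma bounded_linear_cconj: "bounded_linear (cconj :: 'n::finite cvec \<Rightarrow> 'n cvec)"
  unfolding linear_conv_bounded_linear[symmetric]
  by (rule linearI) (auto simp: cconj_def)

lemma cconj_cconj [simp]: "cconj (cconj Z) = Z"
  by (simp add: cconj_def)

lemma cconj_diff: "cconj (X - Y) = cconj X - cconj Y"
  by (simp add: cconj_def)

lemma bounded_bilinear_pair_CT: "bounded_bilinear (pair_CT :: _ \<Rightarrow> 'n::finite cvec \<Rightarrow> complex)"
proof (rule bounded_bilinear.intro)
  show "\<exists>K. \<forall>\<alpha> (Z::'n cvec). norm (pair_CT \<alpha> Z) \<le> norm \<alpha> * norm Z * K"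
  proof (intro exI allI)
    fix \<alpha> and Z :: "'n cvec"
    have "norm (pair_CT \<alpha> Z) \<le> \<bar>blinfun_apply \<alpha> (fst Z)\<bar> + \<bar>blinfun_apply \<alpha> (snd Z)\<bar>"
      using cmod_le[of "pair_CT \<alpha> Z"] by (simp add: pair_CT_def)
    also have "\<dots> \<le> norm \<alpha> * norm (fst Z) + norm \<alpha> * norm (snd Z)"
      using norm_blinfun[of \<alpha>] by (intro add_mono) auto
    also have "\<dots> \<le> norm \<alpha> * norm Z + norm \<alpha> * norm Z"
      using norm_fst_le[of "fst Z" "snd Z"] norm_snd_le[of "snd Z" "fst Z"]
      by (intro add_mono mult_left_mono) auto
    finally show "norm (pair_CT \<alpha> Z) \<le> norm \<alpha> * norm Z * 2" by (simp add: mult_ac)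
  qed
qed (auto simp: pair_CT_def blinfun.bilinear_simps complex_eq_iff)

lemma pair_CT_cscale: "pair_CT \<alpha> (cscale c Z) = c * pair_CT \<alpha> Z"
  by (simp add: pair_CT_def cscale_def blinfun.bilinear_simps complex_eq_iff)

lemma pair_CT_cconj: "pair_CT \<alpha> (cconj Z) = cnj (pair_CT \<alpha> Z)"
  by (simp add: pair_CT_def cconj_def blinfun.bilinear_simps complex_eq_iff)

lemmas pair_CT_simps = bounded_bilinear.add_left[OF bounded_bilinear_pair_CT]
  bounded_bilinear.add_right[OF bounded_bilinear_pair_CT]
  bounded_bilinear.diff_left[OF bounded_bilinear_pair_CT]
  bounded_bilinear.diff_right[OF bounded_bilinear_pair_CT]
  bounded_bilinear.minus_left[OF bounded_bilinear_pair_CT]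
  bounded_bilinear.minus_right[OF bounded_bilinear_pair_CT]
  bounded_bilinear.scaleR_left[OF bounded_bilinear_pair_CT]
  bounded_bilinear.scaleR_right[OF bounded_bilinear_pair_CT]
  bounded_bilinear.zero_left[OF bounded_bilinear_pair_CT]
  bounded_bilinear.zero_right[OF bounded_bilinear_pair_CT]
  pair_CT_cscale

text \<open>The complex bilinear extension of \<open>(D\<^sub>X \<Theta>)(Y)\<close>.\<close>

definition pair_deriv ::
  "(complex^'n \<Rightarrow> (complex^'n) \<Rightarrow>\<^sub>L real) \<Rightarrow> complex^'n \<Rightarrow> 'n cvec \<Rightarrow> 'n cvec \<Rightarrow> complex" where
  "pair_deriv \<Theta> x X Y = pair_CT (frechet_derivative \<Theta> (at x) (fst X)) Y
     + \<i> * pair_CT (frechet_derivative \<Theta> (at x) (snd X)) Y"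

text \<open>The complex bilinear extension of \<open>- d\<Theta>\<close>. With this sign, Cartan's formula says that it
  is the pairing of \<open>\<Theta>\<close> with the bracket of two fields annihilated by \<open>\<Theta>\<close>.\<close>

definition bracket_form ::
  "(complex^'n \<Rightarrow> (complex^'n) \<Rightarrow>\<^sub>L real) \<Rightarrow> complex^'n \<Rightarrow> 'n cvec \<Rightarrow> 'n cvec \<Rightarrow> complex" where
  "bracket_form \<Theta> x X Y = pair_deriv \<Theta> x Y X - pair_deriv \<Theta> x X Y"

lemma bracket_form_antisym: "bracket_form \<Theta> x X Y = - bracket_form \<Theta> x Y X"
  by (simp add: bracket_form_def)

context
  fixes \<Theta> :: "complex^'n \<Rightarrow> (complex^'n) \<Rightarrow>\<^sub>L real" and x :: "complex^'n"
  assumes diff: "\<Theta> differentiable (at x)"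
begin

lemma pair_deriv_add: "pair_deriv \<Theta> x (X + X') Y = pair_deriv \<Theta> x X Y + pair_deriv \<Theta> x X' Y"
  "pair_deriv \<Theta> x X (Y + Y') = pair_deriv \<Theta> x X Y + pair_deriv \<Theta> x X Y'"
  using linear_add[OF linear_frechet_derivative[OF diff]]
  by (auto simp: pair_deriv_def pair_CT_simps algebra_simps)

lemma pair_deriv_cscale: "pair_deriv \<Theta> x (cscale c X) Y = c * pair_deriv \<Theta> x X Y"
  "pair_deriv \<Theta> x X (cscale c Y) = c * pair_deriv \<Theta> x X Y"
proof -
  note lin = linear_frechet_derivative[OF diff]
  show "pair_deriv \<Theta> x (cscale c X) Y = c * pair_deriv \<Theta> x X Y"
    by (simp add: pair_deriv_def cscale_def linear_add[OF lin] linear_diff[OF lin]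
        linear_scale[OF lin] pair_CT_simps complex_eq_iff) (simp add: algebra_simps)
  show "pair_deriv \<Theta> x X (cscale c Y) = c * pair_deriv \<Theta> x X Y"
    by (auto simp: pair_deriv_def pair_CT_simps algebra_simps)
qed

lemma pair_deriv_cconj: "pair_deriv \<Theta> x (cconj X) (cconj Y) = cnj (pair_deriv \<Theta> x X Y)"
proof -
  have neg: "frechet_derivative \<Theta> (at x) (- v) = - frechet_derivative \<Theta> (at x) v" for v
    using linear_neg[OF linear_frechet_derivative[OF diff]] .
  show ?thesis
    by (simp add: pair_deriv_def pair_CT_cconj) (simp add: cconj_def neg pair_CT_simps)
qed

lemma bracket_form_add: "bracket_form \<Theta> x (X + X') Y = bracket_form \<Theta> x X Y + bracket_form \<Theta> x X' Y"
  "bracket_form \<Theta> x X (Y + Y') = bracket_form \<Theta> x X Y + bracket_form \<Theta> x X Y'"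
  by (auto simp: bracket_form_def pair_deriv_add)

lemma bracket_form_cscale: "bracket_form \<Theta> x (cscale c X) Y = c * bracket_form \<Theta> x X Y"
  "bracket_form \<Theta> x X (cscale c Y) = c * bracket_form \<Theta> x X Y"
  by (auto simp: bracket_form_def pair_deriv_cscale algebra_simps)

lemma bracket_form_cconj: "bracket_form \<Theta> x (cconj X) (cconj Y) = cnj (bracket_form \<Theta> x X Y)"
  by (simp add: bracket_form_def pair_deriv_cconj)

lemma bracket_form_linear: "linear (\<lambda>X. bracket_form \<Theta> x X Y)" "linear (bracket_form \<Theta> x X)"
proof -
  have sc: "r *\<^sub>R Z = cscale (complex_of_real r) Z" for r and Z :: "'n cvec"
    by (simp add: cscale_def scaleR_prod_def)
  show "linear (\<lambda>X. bracket_form \<Theta> x X Y)" "linear (bracket_form \<Theta> x X)"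
    by (rule linearI; simp only: bracket_form_add sc bracket_form_cscale scaleR_conv_of_real)+
qed

end

lemma smooth_on_bracket_form:
  assumes U: "open U" and \<Theta>: "smooth_on U \<Theta>"
  shows "smooth_on U (\<lambda>y. bracket_form \<Theta> y b c)"
proof -
  have "smooth_on U (\<lambda>y. pair_CT (frechet_derivative \<Theta> (at y) v) Z)" for v Z
    by (rule smooth_on_bilinear[OF bounded_bilinear_pair_CT U
          smooth_on_frechet_derivative[OF \<Theta>] smooth_on_const])
  then show ?thesis unfolding bracket_form_def pair_deriv_def
    by (intro smooth_on_diff smooth_on_add U
        smooth_on_bounded_linear[OF bounded_linear_mult_right])
qed


section \<open>Tangent spaces of a real hypersurface\<close>

lemma defining_funD:
  assumes "defining_fun M x U r"
  shows "open U" "x \<in> U" "smooth_on U r" "y \<in> U \<Longrightarrow> defining_fun M y U r"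
    "y \<in> U \<Longrightarrow> \<exists>v. frechet_derivative r (at y) v \<noteq> 0"
    "y \<in> U \<Longrightarrow> linear (frechet_derivative r (at y))"
  using assms linear_frechet_derivative smooth_on_differentiable
  unfolding defining_fun_def by blast+

lemma defining_fun_smooth_on_pairing:
  assumes def: "defining_fun M x U r" and F: "smooth_on V F" and V: "open V" "V \<subseteq> U"
  shows "smooth_on V (\<lambda>y. frechet_derivative r (at y) (F y))"
proof (rule smooth_on_linear_family[OF V(1) _ _ F])
  show "linear (frechet_derivative r (at y))" if "y \<in> V" for y
    using defining_funD(6)[OF def] that V by auto
  show "smooth_on V (\<lambda>y. frechet_derivative r (at y) b)" for b
    using smooth_on_frechet_derivative smooth_on_subset defining_funD(3)[OF def] V(2) by blast
qed

lemma mult_ii_ii [simp]: "\<i> *s (\<i> *s v) = - (v::complex^'n)"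
  by (simp add: vec_eq_iff)

lemma vec_scale_expand: "c *s (v::complex^'n) = Re c *\<^sub>R v + Im c *\<^sub>R (\<i> *s v)"
proof -
  have "c * z = Re c *\<^sub>R z + Im c *\<^sub>R (\<i> * z)" for z
    by (simp add: complex_eq_iff)
  then show ?thesis by (simp add: vec_eq_iff)
qed

lemma bounded_linear_mult_ii: "bounded_linear (\<lambda>v::complex^'n. \<i> *s v)"
  unfolding linear_conv_bounded_linear[symmetric]
  by (rule linearI) (auto simp: vec_eq_iff algebra_simps)

lemma mult_ii_simps:
  "\<i> *s (v + w) = \<i> *s v + \<i> *s (w::complex^'n)" "\<i> *s (v - w) = \<i> *s v - \<i> *s w"
  "\<i> *s (- v) = - (\<i> *s v)" "\<i> *s (a *\<^sub>R v) = a *\<^sub>R (\<i> *s v)" "\<i> *s (0::complex^'n) = 0"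
  by (auto simp: vec_eq_iff algebra_simps)

lemma bounded_bilinear_vec_scale: "bounded_bilinear (\<lambda>c (v::complex^'n). c *s v)"
  unfolding bilinear_conv_bounded_bilinear[symmetric] bilinear_def
  by (auto intro!: linearI simp: vec_eq_iff algebra_simps)

lemma CT_iff: "Z \<in> CT M x \<longleftrightarrow> fst Z \<in> tangent_space M x \<and> snd Z \<in> tangent_space M x"
  by (cases Z) (simp add: CT_def)

lemma CH_iff: "Z \<in> CH M x \<longleftrightarrow> fst Z \<in> complex_tangent M x \<and> snd Z \<in> complex_tangent M x"
  by (cases Z) (simp add: CH_def)

lemma H10_iff: "Z \<in> H10 M x \<longleftrightarrow> fst Z \<in> complex_tangent M x \<and> snd Z \<in> complex_tangent M x
    \<and> cJ Z = cscale \<i> Z"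
  by (simp add: H10_def CH_iff)

lemma H01_iff: "Z \<in> H01 M x \<longleftrightarrow> cconj Z \<in> H10 M x"
  unfolding H01_def by (metis (no_types, lifting) cconj_cconj image_iff)

lemma complex_tangent_subset: "complex_tangent M x \<subseteq> tangent_space M x"
  by (auto simp: complex_tangent_def)

lemma CH_subset_CT: "CH M x \<subseteq> CT M x"
  using complex_tangent_subset by (auto simp: CT_def CH_def)

lemma H10_subset_CH: "H10 M x \<subseteq> CH M x"
  by (auto simp: H10_def)

lemma cJ_simps: "cJ (X + Y) = cJ X + cJ (Y::'n::finite cvec)" "cJ (cscale c X) = cscale c (cJ X)" "cJ (0::'n::finite cvec) = 0"
  by (auto simp: cJ_def cscale_def mult_ii_simps zero_prod_def)

lemma K10_subset_H10: "K10 M x \<subseteq> H10 M x"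
  by (auto simp: K10_def)

locale hypersurface =
  fixes M :: "(complex^'n) set"
  assumes hyp: "real_hypersurface M"
begin

lemma obtain_defining_fun:
  assumes "x \<in> M"
  obtains U r where "defining_fun M x U r"
  using hyp assms by (auto simp: real_hypersurface_def)

lemma subspace_tangent_space: "x \<in> M \<Longrightarrow> subspace (tangent_space M x)"
proof -
  assume x: "x \<in> M"
  obtain U r where def: "defining_fun M x U r" using obtain_defining_fun[OF x] .
  show ?thesis unfolding tangent_space_eq[OF def x]
    using linear_subspace_kernel[OF defining_funD(6)[OF def defining_funD(2)[OF def]]] .
qed

lemma subspace_complex_tangent: "x \<in> M \<Longrightarrow> subspace (complex_tangent M x)"
  using subspace_tangent_space[of x]
  by (auto simp: subspace_def complex_tangent_def mult_ii_simps)

lemma mult_ii_complex_tangent: "x \<in> M \<Longrightarrow> v \<in> complex_tangent M x \<Longrightarrow> \<i> *s v \<in> complex_tangent M x"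
  using subspace_neg[OF subspace_tangent_space[of x]] by (auto simp: complex_tangent_def)

lemma cplx_subspace_CT: "x \<in> M \<Longrightarrow> cplx.subspace (CT M x)"
  using subspace_tangent_space[of x]
  by (auto simp: cplx.subspace_def CT_iff cscale_def subspace_def subspace_diff)

lemma cplx_subspace_CH: "x \<in> M \<Longrightarrow> cplx.subspace (CH M x)"
  using subspace_complex_tangent[of x]
  by (auto simp: cplx.subspace_def CH_iff cscale_def subspace_def subspace_diff)

lemma cplx_subspace_H10: "x \<in> M \<Longrightarrow> cplx.subspace (H10 M x)"
  using cplx_subspace_CH[of x]
  by (auto simp: cplx.subspace_def H10_def cJ_simps cplx.scale_right_distrib mult.commute)

lemma cconj_CH: "x \<in> M \<Longrightarrow> Z \<in> CH M x \<Longrightarrow> cconj Z \<in> CH M x"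
  using subspace_neg[OF subspace_complex_tangent] by (simp add: CH_iff cconj_def)

lemma H01_subset_CH: "x \<in> M \<Longrightarrow> H01 M x \<subseteq> CH M x"
  using H10_subset_CH cconj_CH by (force simp: H01_def)

text \<open>Differentiate the identity \<open>dr(A) = 0\<close>, valid along \<open>M\<close>, in a tangential direction.\<close>

lemma defining_fun_mderiv_tangent_field:
  assumes def: "defining_fun M x U r" and x: "x \<in> M"
    and A: "smooth_near M x A" "\<forall>\<^sub>F y in nhds x. y \<in> M \<longrightarrow> A y \<in> tangent_space M y"
    and u: "u \<in> tangent_space M x"
  shows "frechet_derivative r (at x) (mderiv M A x u) =
    - frechet_derivative (\<lambda>y. frechet_derivative r (at y) (A x)) (at x) u"
proof -
  have "\<forall>\<^sub>F y in nhds x. y \<in> U"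
    using defining_funD(1,2)[OF def] by (rule eventually_nhds_in_open)
  then have ev: "\<forall>\<^sub>F y in nhds x. y \<in> U \<and> (y \<in> M \<longrightarrow> A y \<in> tangent_space M y)"
    using A(2) by (rule eventually_conj)
  obtain V F where F: "smooth_ext M x A V F"
    and V: "\<And>y. y \<in> V \<Longrightarrow> y \<in> U \<and> (y \<in> M \<longrightarrow> A y \<in> tangent_space M y)"
    using smooth_nearE[OF A(1) ev] by blast
  note F' = smooth_extD[OF F]
  let ?h = "\<lambda>y. frechet_derivative r (at y) (F y)"
  have "?h y = 0" if y: "y \<in> M" "y \<in> V" for y
  proof -
    have "F y \<in> tangent_space M y" using V[OF y(2)] F'(4)[OF y] y by simp
    then show ?thesis
      using tangent_space_eq[OF defining_funD(4)[OF def] y(1)] V[OF y(2)] by simp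
  qed
  moreover have "smooth_on V ?h"
    using V by (intro defining_fun_smooth_on_pairing[OF def F'(3) F'(1)]) auto
  ultimately have "smooth_ext M x (\<lambda>_. 0) V ?h"
    using F' by (simp add: smooth_ext_def)
  then have "frechet_derivative ?h (at x) u = 0"
    using u by (auto simp: tangent_space_def)
  moreover have "frechet_derivative ?h (at x) u = frechet_derivative r (at x) (frechet_derivative F (at x) u)
      + frechet_derivative (\<lambda>y. frechet_derivative r (at y) (F x)) (at x) u"
    using V smooth_on_frechet_derivative[OF smooth_on_subset[OF defining_funD(3)[OF def]], of V]
    by (intro frechet_derivative_linear_family[OF F'(1) _ _ F'(3,2)] defining_funD(6)[OF def]) auto
  ultimately show ?thesis
    using F'(4)[OF x F'(2)] by (simp add: mderiv_eq[OF F u])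
qed

lemma mderiv_vanishing_tangent_field:
  assumes x: "x \<in> M"
    and A: "smooth_near M x A" "\<forall>\<^sub>F y in nhds x. y \<in> M \<longrightarrow> A y \<in> tangent_space M y"
    and A0: "A x = 0" and u: "u \<in> tangent_space M x"
  shows "mderiv M A x u \<in> tangent_space M x"
proof -
  obtain U r where def: "defining_fun M x U r" using obtain_defining_fun[OF x] .
  have "((\<lambda>y. frechet_derivative r (at y) 0) has_derivative (\<lambda>_. 0)) (at x)"
    by (rule has_derivative_transform_within_open[OF has_derivative_const
          defining_funD(1,2)[OF def], of 0])
      (simp add: linear_0[OF defining_funD(6)[OF def]])
  then show ?thesis
    using defining_fun_mderiv_tangent_field[OF def x A u]
    by (simp add: tangent_space_eq[OF def x] A0 flip: frechet_derivative_at)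
qed

text \<open>By the preceding formula, applying \<open>dr\<close> to the two terms of the bracket gives the mixed second
  derivatives of \<open>r\<close> along \<open>A\<close> and \<open>B\<close>, in the two possible orders.\<close>

lemma real_bracket_tangent:
  assumes x: "x \<in> M"
    and A: "smooth_near M x A" "\<forall>\<^sub>F y in nhds x. y \<in> M \<longrightarrow> A y \<in> tangent_space M y"
    and B: "smooth_near M x B" "\<forall>\<^sub>F y in nhds x. y \<in> M \<longrightarrow> B y \<in> tangent_space M y"
  shows "mderiv M B x (A x) - mderiv M A x (B x) \<in> tangent_space M x"
proof -
  obtain U r where def: "defining_fun M x U r" using obtain_defining_fun[OF x] .
  have AB: "A x \<in> tangent_space M x" "B x \<in> tangent_space M x"
    using eventually_nhds_x_imp_x[OF A(2)] eventually_nhds_x_imp_x[OF B(2)] x by auto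
  show ?thesis
    using defining_fun_mderiv_tangent_field[OF def x A AB(2)]
      defining_fun_mderiv_tangent_field[OF def x B AB(1)]
      second_derivative_commute[OF defining_funD(1-3)[OF def], of "A x" "B x"]
    by (simp add: tangent_space_eq[OF def x]
        linear_diff[OF defining_funD(6)[OF def defining_funD(2)[OF def]]])
qed


section \<open>Local sections\<close>

lemma local_section_iff:
  "local_section M x V X \<longleftrightarrow> smooth_near M x X \<and> (\<forall>\<^sub>F y in nhds x. y \<in> M \<longrightarrow> X y \<in> V y)"
  by (auto simp: local_section_def eventually_nhds)

lemma local_section_at: "local_section M x V X \<Longrightarrow> x \<in> M \<Longrightarrow> X x \<in> V x"
  unfolding local_section_iff using eventually_nhds_x_imp_x by blast

lemma local_section_eventually:
  "local_section M x V X \<Longrightarrow> \<forall>\<^sub>F y in nhds x. local_section M y V X"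
  unfolding local_section_iff
  by (auto intro: eventually_conj smooth_near_eventually simp: eventually_eventually)

lemma local_section_mono:
  assumes "local_section M x V X" "\<And>y. y \<in> M \<Longrightarrow> V y \<subseteq> W y"
  shows "local_section M x W X"
  using assms unfolding local_section_iff by (auto elim!: eventually_mono)

lemma local_section_add:
  assumes "local_section M x V X" "local_section M x V Y" "\<And>y. y \<in> M \<Longrightarrow> cplx.subspace (V y)"
  shows "local_section M x V (\<lambda>y. X y + Y y)"
proof -
  have "\<forall>\<^sub>F y in nhds x. y \<in> M \<longrightarrow> X y \<in> V y" "\<forall>\<^sub>F y in nhds x. y \<in> M \<longrightarrow> Y y \<in> V y"
    using assms(1,2) by (auto simp: local_section_iff)
  then have "\<forall>\<^sub>F y in nhds x. y \<in> M \<longrightarrow> X y + Y y \<in> V y"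
    by eventually_elim (use assms(3) cplx.subspace_add in blast)
  with assms(1,2) smooth_near_add show ?thesis by (auto simp: local_section_iff)
qed

lemma local_section_cscale:
  assumes "local_section M x V X" "\<And>y. y \<in> M \<Longrightarrow> cplx.subspace (V y)"
  shows "local_section M x V (\<lambda>y. cscale c (X y))"
  using assms unfolding local_section_iff
  by (auto intro: smooth_near_bounded_linear[OF bounded_linear_cscale] cplx.subspace_scale
      elim!: eventually_mono)

lemma local_section_diff:
  assumes "local_section M x V X" "local_section M x V Y" "\<And>y. y \<in> M \<Longrightarrow> cplx.subspace (V y)"
  shows "local_section M x V (\<lambda>y. X y - Y y)"
proof -
  have "\<forall>\<^sub>F y in nhds x. y \<in> M \<longrightarrow> X y \<in> V y" "\<forall>\<^sub>F y in nhds x. y \<in> M \<longrightarrow> Y y \<in> V y"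
    using assms(1,2) by (auto simp: local_section_iff)
  then have "\<forall>\<^sub>F y in nhds x. y \<in> M \<longrightarrow> X y - Y y \<in> V y"
    by eventually_elim (use assms(3) cplx.subspace_diff in blast)
  with assms(1,2) smooth_near_diff show ?thesis by (auto simp: local_section_iff)
qed

lemma local_section_sum:
  assumes "\<And>i. i \<in> I \<Longrightarrow> local_section M x V (X i)" "\<And>y. y \<in> M \<Longrightarrow> cplx.subspace (V y)"
  shows "local_section M x V (\<lambda>y. \<Sum>i\<in>I. X i y)"
  using assms(1)
proof (induction I rule: infinite_finite_induct)
  case (insert i I)
  then show ?case using assms(2) by (simp add: local_section_add)
qed (use assms(2) cplx.subspace_0 in
    \<open>auto simp: local_section_iff intro!: smooth_near_smooth_on[OF open_UNIV] smooth_on_const always_eventually\<close>)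

lemma local_section_conj_field:
  assumes "local_section M x V X" "\<And>y Z. y \<in> M \<Longrightarrow> Z \<in> V y \<Longrightarrow> cconj Z \<in> W y"
  shows "local_section M x W (conj_field X)"
  using assms(1) unfolding local_section_iff conj_field_def
  by (auto intro: smooth_near_bounded_linear[OF bounded_linear_cconj]
      elim!: eventually_mono simp: assms(2) split_paired_all)

lemma local_section_H01_conj_field:
  "local_section M x (H10 M) X \<Longrightarrow> local_section M x (H01 M) (conj_field X)"
  by (rule local_section_conj_field) (auto simp: H01_iff)

lemma local_section_H10_CH: "local_section M x (H10 M) X \<Longrightarrow> local_section M x (CH M) X"
  using local_section_mono H10_subset_CH by blast

lemma local_section_H01_CH: "local_section M x (H01 M) X \<Longrightarrow> local_section M x (CH M) X"
  using local_section_mono H01_subset_CH by blast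

lemma local_section_CH_CT: "local_section M x (CH M) X \<Longrightarrow> local_section M x (CT M) X"
  using local_section_mono CH_subset_CT by blast

text \<open>With \<open>dr\<^sub>x(w) = 1\<close>, the field \<open>dr(w) u - dr(u) w\<close> is annihilated by \<open>dr\<close> and takes the
  value \<open>u\<close> at \<open>x\<close>; avoiding a division, it is visibly smooth.\<close>

lemma tangent_field_through:
  assumes x: "x \<in> M" and u: "u \<in> tangent_space M x"
  obtains A where "smooth_near M x A" "\<forall>\<^sub>F y in nhds x. y \<in> M \<longrightarrow> A y \<in> tangent_space M y" "A x = u"
proof -
  obtain U r where def: "defining_fun M x U r" using obtain_defining_fun[OF x] .
  note U = defining_funD[OF def]
  let ?r' = "\<lambda>y. frechet_derivative r (at y)"
  obtain w0 where w0: "?r' x w0 \<noteq> 0" using U(5)[OF U(2)] by blast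
  define w where "w = (1 / ?r' x w0) *\<^sub>R w0"
  have w: "?r' x w = 1" using w0 by (simp add: w_def linear_scale[OF U(6)[OF U(2)]])
  define A where "A y = ?r' y w *\<^sub>R u - ?r' y u *\<^sub>R w" for y
  have "smooth_on U A" unfolding A_def
    by (intro smooth_on_diff smooth_on_bilinear[OF bounded_bilinear_scaleR] U(1) smooth_on_const
        smooth_on_frechet_derivative U(3))
  then have "smooth_near M x A" using U smooth_near_smooth_on by blast
  moreover have "A y \<in> tangent_space M y" if "y \<in> U" "y \<in> M" for y
    using tangent_space_eq[OF U(4)[OF that(1)] that(2)]
    by (simp add: A_def linear_diff[OF U(6)[OF that(1)]] linear_scale[OF U(6)[OF that(1)]])
  then have "\<forall>\<^sub>F y in nhds x. y \<in> M \<longrightarrow> A y \<in> tangent_space M y"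
    using U(1,2) by (auto simp: eventually_nhds)
  moreover have "A x = u" using u by (simp add: A_def w tangent_space_eq[OF def x])
  ultimately show ?thesis using that by blast
qed

lemma CT_section_through:
  assumes x: "x \<in> M" and Z: "Z \<in> CT M x"
  obtains X where "local_section M x (CT M) X" "X x = Z"
proof -
  have Z': "fst Z \<in> tangent_space M x" "snd Z \<in> tangent_space M x"
    using Z by (auto simp: CT_iff)
  obtain A where A: "smooth_near M x A" "\<forall>\<^sub>F y in nhds x. y \<in> M \<longrightarrow> A y \<in> tangent_space M y" "A x = fst Z"
    using tangent_field_through[OF x Z'(1)] .
  obtain B where B: "smooth_near M x B" "\<forall>\<^sub>F y in nhds x. y \<in> M \<longrightarrow> B y \<in> tangent_space M y" "B x = snd Z"
    using tangent_field_through[OF x Z'(2)] .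
  have "\<forall>\<^sub>F y in nhds x. y \<in> M \<longrightarrow> (A y, B y) \<in> CT M y"
    using A(2) B(2) by eventually_elim (simp add: CT_iff)
  then have "local_section M x (CT M) (\<lambda>y. (A y, B y))" "(A x, B x) = Z"
    using smooth_near_Pair[OF A(1) B(1)] A(3) B(3) by (auto simp: local_section_iff)
  with that show ?thesis .
qed

text \<open>The same device as for tangent fields, with \<open>dr\<close> replaced by the complex linear functional
  \<open>v \<mapsto> dr(v) - i dr(i v)\<close>, whose kernel is the complex tangent space.\<close>

lemma H10_section_through:
  assumes x: "x \<in> M" and Z: "Z \<in> H10 M x"
  obtains X where "local_section M x (H10 M) X" "X x = Z"
proof -
  obtain U r where def: "defining_fun M x U r" using obtain_defining_fun[OF x] .
  note U = defining_funD[OF def]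
  let ?r' = "\<lambda>y. frechet_derivative r (at y)"
  define l where "l y v = complex_of_real (?r' y v) - \<i> * complex_of_real (?r' y (\<i> *s v))" for y v
  have l_scale: "l y (c *s v) = c * l y v" if "y \<in> U" for y c v
    unfolding l_def vec_scale_expand[of c v] mult_ii_simps mult_ii_ii
    using linear_add[OF U(6)[OF that]] linear_scale[OF U(6)[OF that]] linear_diff[OF U(6)[OF that]]
    by (simp add: complex_eq_iff)
  have l_diff: "l y (v - w) = l y v - l y w" if "y \<in> U" for y v w
    unfolding l_def mult_ii_simps using U(6)[OF that] by (simp add: linear_diff algebra_simps)
  have H: "v \<in> complex_tangent M y \<longleftrightarrow> l y v = 0" if "y \<in> U" "y \<in> M" for y v
    using tangent_space_eq[OF U(4)[OF that(1)] that(2)]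
    by (simp add: complex_tangent_def l_def complex_eq_iff)
  obtain w0 where w0: "?r' x w0 \<noteq> 0" using U(5)[OF U(2)] by blast
  then have l0: "l x w0 \<noteq> 0" by (simp add: l_def complex_eq_iff)
  define w where "w = (1 / l x w0) *s w0"
  have w: "l x w = 1" using l0 by (simp add: w_def l_scale[OF U(2)])
  define a where "a = fst Z"
  have a: "l x a = 0" "snd Z = - (\<i> *s a)"
  proof -
    show "l x a = 0" using Z H[OF U(2) x] by (simp add: H10_iff a_def)
    have "\<i> *s fst Z = - snd Z" using Z by (simp add: H10_iff cJ_def cscale_def)
    then show "snd Z = - (\<i> *s a)" by (simp add: a_def)
  qed
  define g where "g y = l y w *s a - l y a *s w" for y
  have sml: "smooth_on U (\<lambda>y. l y v)" for v
    unfolding l_def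
    by (intro smooth_on_diff smooth_on_bounded_linear[OF bounded_linear_mult_right]
        smooth_on_bounded_linear[OF bounded_linear_of_real] smooth_on_frechet_derivative U)
  have smg: "smooth_on U g" unfolding g_def
    by (intro smooth_on_diff smooth_on_bilinear[OF bounded_bilinear_vec_scale] sml smooth_on_const U(1))
  have "bounded_linear (\<lambda>v::complex^'n. (v, - (\<i> *s v)))"
    by (intro bounded_linear_Pair bounded_linear_ident bounded_linear_minus bounded_linear_mult_ii)
  from smooth_on_bounded_linear[OF this U(1) smg]
  have "smooth_near M x (\<lambda>y. (g y, - (\<i> *s g y)))" using U smooth_near_smooth_on by blast
  moreover have "(g y, - (\<i> *s g y)) \<in> H10 M y" if y: "y \<in> U" "y \<in> M" for y
  proof -
    have "l y (g y) = 0" unfolding g_def using y by (simp add: l_diff l_scale)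
    then have "g y \<in> complex_tangent M y" using H[OF y] by blast
    with mult_ii_complex_tangent[OF y(2) this] subspace_neg[OF subspace_complex_tangent[OF y(2)]]
    show ?thesis by (simp add: H10_iff cJ_def cscale_def mult_ii_simps)
  qed
  then have "\<forall>\<^sub>F y in nhds x. y \<in> M \<longrightarrow> (g y, - (\<i> *s g y)) \<in> H10 M y"
    using U(1,2) by (auto simp: eventually_nhds)
  moreover have "(g x, - (\<i> *s g x)) = Z"
    using a by (simp add: g_def w a_def prod_eq_iff)
  ultimately show ?thesis using that[of "\<lambda>y. (g y, - (\<i> *s g y))"] by (simp add: local_section_iff)
qed

text \<open>The condition to be of type (1,0) consists of linear equations depending on the point. At a
  zero of \<open>G\<close> their dependence on the point does not contribute to the derivative, so the derivative
  of \<open>G\<close> satisfies the same equations.\<close>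

lemma mderiv_vanishing_H10_section:
  assumes x: "x \<in> M" and G: "local_section M x (H10 M) G" "G x = 0" and u: "u \<in> tangent_space M x"
  shows "mderiv M G x u \<in> H10 M x"
proof -
  have smG: "smooth_near M x G" and ev: "\<forall>\<^sub>F y in nhds x. y \<in> M \<longrightarrow> G y \<in> H10 M y"
    using G by (auto simp: local_section_iff)
  have T: "h (mderiv M G x u) \<in> tangent_space M x"
    if h: "bounded_linear h" and hT: "\<And>y Z. y \<in> M \<Longrightarrow> Z \<in> H10 M y \<Longrightarrow> h Z \<in> tangent_space M y" for h
  proof -
    have "h (G x) = 0" using h G(2) by (simp add: linear_0 bounded_linear.linear)
    moreover have "\<forall>\<^sub>F y in nhds x. y \<in> M \<longrightarrow> h (G y) \<in> tangent_space M y"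
      using ev by (rule eventually_mono) (use hT in blast)
    ultimately have "mderiv M (\<lambda>y. h (G y)) x u \<in> tangent_space M x"
      using mderiv_vanishing_tangent_field[OF x smooth_near_bounded_linear[OF h smG]] u by blast
    then show ?thesis using mderiv_bounded_linear[OF h smG u] by simp
  qed
  have "fst (mderiv M G x u) \<in> tangent_space M x"
    by (rule T[OF bounded_linear_fst]) (auto simp: H10_iff complex_tangent_def)
  moreover have "snd (mderiv M G x u) \<in> tangent_space M x"
    by (rule T[OF bounded_linear_snd]) (auto simp: H10_iff complex_tangent_def)
  moreover have "\<i> *s fst (mderiv M G x u) \<in> tangent_space M x"
    by (rule T[OF bounded_linear_compose[OF bounded_linear_mult_ii bounded_linear_fst]])
      (auto simp: H10_iff complex_tangent_def)
  moreover have "\<i> *s snd (mderiv M G x u) \<in> tangent_space M x"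
    by (rule T[OF bounded_linear_compose[OF bounded_linear_mult_ii bounded_linear_snd]])
      (auto simp: H10_iff complex_tangent_def)
  moreover have "cJ (mderiv M G x u) = cscale \<i> (mderiv M G x u)"
  proof -
    have "mderiv M (\<lambda>y. cJ (G y)) x u = mderiv M (\<lambda>y. cscale \<i> (G y)) x u"
      by (rule mderiv_cong) (use ev in \<open>auto simp: H10_iff elim!: eventually_mono\<close>)
    then show ?thesis
      using mderiv_bounded_linear[OF bounded_linear_cJ smG u]
        mderiv_bounded_linear[OF bounded_linear_cscale smG u] by simp
  qed
  ultimately show ?thesis by (simp add: H10_iff complex_tangent_def)
qed

lemma bracket_in_CT:
  assumes x: "x \<in> M" and X: "local_section M x (CT M) X" and Y: "local_section M x (CT M) Y"
  shows "bracket M X Y x \<in> CT M x"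
proof -
  have sm: "smooth_near M x X" "smooth_near M x Y"
    and ev: "\<forall>\<^sub>F y in nhds x. y \<in> M \<longrightarrow> X y \<in> CT M y" "\<forall>\<^sub>F y in nhds x. y \<in> M \<longrightarrow> Y y \<in> CT M y"
    using X Y by (auto simp: local_section_iff)
  have XY: "fst (X x) \<in> tangent_space M x" "snd (X x) \<in> tangent_space M x"
    "fst (Y x) \<in> tangent_space M x" "snd (Y x) \<in> tangent_space M x"
    using local_section_at[OF X x] local_section_at[OF Y x] by (auto simp: CT_iff)
  have T: "k (mderiv M Y x (h (X x))) - h (mderiv M X x (k (Y x))) \<in> tangent_space M x"
    if h: "bounded_linear h" "h = fst \<or> h = snd" and k: "bounded_linear k" "k = fst \<or> k = snd" for h k
  proof -
    have "mderiv M (\<lambda>y. k (Y y)) x (h (X x)) - mderiv M (\<lambda>y. h (X y)) x (k (Y x)) \<in> tangent_space M x"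
    proof (rule real_bracket_tangent[OF x])
      show "smooth_near M x (\<lambda>y. h (X y))" "smooth_near M x (\<lambda>y. k (Y y))"
        using smooth_near_bounded_linear h(1) k(1) sm by blast+
      show "\<forall>\<^sub>F y in nhds x. y \<in> M \<longrightarrow> h (X y) \<in> tangent_space M y"
        using ev(1) by (rule eventually_mono) (use h(2) in \<open>auto simp: CT_iff\<close>)
      show "\<forall>\<^sub>F y in nhds x. y \<in> M \<longrightarrow> k (Y y) \<in> tangent_space M y"
        using ev(2) by (rule eventually_mono) (use k(2) in \<open>auto simp: CT_iff\<close>)
    qed
    moreover have "h (X x) \<in> tangent_space M x" "k (Y x) \<in> tangent_space M x"
      using XY h(2) k(2) by auto
    ultimately show ?thesis
      using mderiv_bounded_linear[OF h(1) sm(1)] mderiv_bounded_linear[OF k(1) sm(2)] by simp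
  qed
  note ff = T[OF bounded_linear_fst _ bounded_linear_fst, simplified]
    and fs = T[OF bounded_linear_fst _ bounded_linear_snd, simplified]
    and sf = T[OF bounded_linear_snd _ bounded_linear_fst, simplified]
    and ss = T[OF bounded_linear_snd _ bounded_linear_snd, simplified]
  have "fst (bracket M X Y x) \<in> tangent_space M x"
    using subspace_diff[OF subspace_tangent_space[OF x] ff ss]
    by (simp add: bracket_def field_deriv_def cscale_def algebra_simps)
  moreover have "snd (bracket M X Y x) \<in> tangent_space M x"
    using subspace_add[OF subspace_tangent_space[OF x] fs sf]
    by (simp add: bracket_def field_deriv_def cscale_def algebra_simps)
  ultimately show ?thesis by (simp add: CT_iff)
qed


section \<open>Contact forms\<close>

lemma contact_form_CH: "contact_form M \<theta> \<Longrightarrow> x \<in> M \<Longrightarrow> Z \<in> CH M x \<Longrightarrow> pair_CT (\<theta> x) Z = 0"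
  by (simp add: contact_form_def CH_iff pair_CT_def complex_eq_iff)

text \<open>A contact form vanishes on complex tangent vectors; here it vanishes on no other tangent vector,
  so that it separates the elements of \<open>\<complex>Q\<close>. This is required near \<open>x\<close>, and not only at \<open>x\<close>, as
  derivatives of pairings with \<open>\<omega>\<close> will be compared with those for other contact forms.\<close>

definition coorients :: "(complex^'n \<Rightarrow> (complex^'n) \<Rightarrow>\<^sub>L real) \<Rightarrow> complex^'n \<Rightarrow> bool" where
  "coorients \<omega> x \<longleftrightarrow> contact_form M \<omega> \<and> (\<forall>\<^sub>F y in nhds x. y \<in> M \<longrightarrow>
     (\<forall>v\<in>tangent_space M y. blinfun_apply (\<omega> y) v = 0 \<longrightarrow> v \<in> complex_tangent M y))"

text \<open>Near \<open>x\<close> the kernel of \<open>v \<mapsto> dr(i v)\<close> in each tangent space is the complex tangent space.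
  Multiplication by a cut-off function makes this form globally defined.\<close>

lemma exists_coorienting_form:
  assumes x: "x \<in> M"
  obtains \<omega> v where "coorients \<omega> x" "v \<in> tangent_space M x" "blinfun_apply (\<omega> x) v = 1"
proof -
  obtain U r where def: "defining_fun M x U r" using obtain_defining_fun[OF x] .
  note U = defining_funD[OF def]
  let ?r' = "\<lambda>y. frechet_derivative r (at y)"
  obtain \<rho> where \<rho>: "\<rho> > 0" "cball x \<rho> \<subseteq> U" using U(1,2) open_contains_cball by metis
  define \<phi> where "\<phi> y = exp_flat 0 (\<rho>\<^sup>2 - (y - x) \<bullet> (y - x))" for y
  have \<phi>: "\<phi> y > 0" if "y \<in> ball x \<rho>" for y
  proof -
    have "norm (y - x) < \<rho>" using that by (simp add: dist_norm norm_minus_commute)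
    then have "(y - x) \<bullet> (y - x) < \<rho>\<^sup>2"
      using \<rho>(1) by (simp add: dot_square_norm power_strict_mono)
    then show ?thesis by (simp add: \<phi>_def exp_flat_def)
  qed
  have \<phi>0: "\<phi> y = 0" if "y \<notin> ball x \<rho>" for y
  proof -
    have "norm (y - x) \<ge> \<rho>" using that by (simp add: dist_norm norm_minus_commute)
    then have "(y - x) \<bullet> (y - x) \<ge> \<rho>\<^sup>2"
      using \<rho>(1) by (simp add: dot_square_norm power_mono)
    then show ?thesis by (simp add: \<phi>_def exp_flat_def)
  qed
  define \<alpha> where "\<alpha> y = (\<Sum>b\<in>Basis. ?r' y (\<i> *s b) *\<^sub>R blinfun_inner_left b)" for y :: "complex^'n"
  have \<alpha>: "blinfun_apply (\<alpha> y) v = ?r' y (\<i> *s v)" if "y \<in> U" for y v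
  proof -
    have lin: "linear (\<lambda>v. ?r' y (\<i> *s v))"
      using linear_compose[OF bounded_linear.linear[OF bounded_linear_mult_ii] U(6)[OF that]]
      by (simp add: o_def)
    have "blinfun_apply (\<alpha> y) v = (\<Sum>b\<in>Basis. (v \<bullet> b) *\<^sub>R ?r' y (\<i> *s b))"
      by (simp add: \<alpha>_def blinfun.sum_left blinfun.scaleR_left mult.commute)
    also have "\<dots> = ?r' y (\<i> *s (\<Sum>b\<in>Basis. (v \<bullet> b) *\<^sub>R b))"
      by (simp only: linear_sum[OF lin] linear_scale[OF lin])
    finally show ?thesis by (simp add: euclidean_representation)
  qed
  define \<omega>0 where "\<omega>0 y = (if y \<in> U then \<phi> y *\<^sub>R \<alpha> y else 0)" for y
  have \<omega>0: "blinfun_apply (\<omega>0 y) v = \<phi> y * ?r' y (\<i> *s v)" if "y \<in> U" for y v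
    using that \<alpha> by (simp add: \<omega>0_def blinfun.scaleR_left)
  have H: "?r' y (\<i> *s v) = 0 \<longleftrightarrow> v \<in> complex_tangent M y"
    if "y \<in> U" "y \<in> M" "v \<in> tangent_space M y" for y v
    using that tangent_space_eq[OF U(4)[OF that(1)] that(2)] by (simp add: complex_tangent_def)
  have "smooth_near M y \<omega>0" for y
  proof (cases "y \<in> U")
    case True
    have "smooth_on U \<alpha>" unfolding \<alpha>_def
      by (intro smooth_on_sum smooth_on_bilinear[OF bounded_bilinear_scaleR] U(1)
          smooth_on_frechet_derivative U(3) smooth_on_const)
    moreover have "smooth_on U \<phi>" unfolding \<phi>_def
      by (intro smooth_on_compose_real[OF smooth_on_exp_flat] smooth_on_diff U(1) smooth_on_const
          smooth_on_bilinear[OF bounded_bilinear_inner] smooth_on_ident)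
    ultimately have "smooth_on U (\<lambda>y. \<phi> y *\<^sub>R \<alpha> y)"
      by (intro smooth_on_bilinear[OF bounded_bilinear_scaleR] U(1))
    then have "smooth_on U \<omega>0"
      by (rule smooth_on_cong[OF U(1), rotated]) (simp add: \<omega>0_def)
    then show ?thesis using U(1) True smooth_near_smooth_on by blast
  next
    case False
    have "smooth_on (- cball x \<rho>) \<omega>0"
      by (rule smooth_on_cong[OF _ _ smooth_on_const[of _ 0]]) (auto simp: \<omega>0_def \<phi>0)
    then show ?thesis using False \<rho>(2)
      by (intro smooth_near_smooth_on[of "- cball x \<rho>"]) auto
  qed
  moreover have "blinfun_apply (\<omega>0 y) v = 0" if "y \<in> M" "v \<in> complex_tangent M y" for y v
    using \<omega>0[of y v] H[of y v] that complex_tangent_subset by (cases "y \<in> U") (auto simp: \<omega>0_def)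
  ultimately have contact0: "contact_form M \<omega>0" by (simp add: contact_form_def)
  obtain w where w: "?r' x w \<noteq> 0" using U(5)[OF U(2)] by blast
  \<comment> \<open>This combination of \<open>w\<close> and \<open>i w\<close> is tangent, and \<open>dr(i v)\<close> is minus a sum of two squares.\<close>
  define v where "v = ?r' x w *\<^sub>R (\<i> *s w) - ?r' x (\<i> *s w) *\<^sub>R w"
  note lin = linear_diff[OF U(6)[OF U(2)]] linear_scale[OF U(6)[OF U(2)]]
    linear_neg[OF U(6)[OF U(2)]]
  have v: "v \<in> tangent_space M x"
    by (simp add: tangent_space_eq[OF def x] v_def lin)
  have "?r' x (\<i> *s v) = - ((?r' x w)\<^sup>2 + (?r' x (\<i> *s w))\<^sup>2)"
    by (simp add: v_def mult_ii_simps lin power2_eq_square)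
  moreover have "(?r' x w)\<^sup>2 + (?r' x (\<i> *s w))\<^sup>2 > 0"
    using w by (simp add: sum_power2_gt_zero_iff)
  ultimately have "?r' x (\<i> *s v) \<noteq> 0" by linarith
  then have nz: "blinfun_apply (\<omega>0 x) v \<noteq> 0"
    using \<omega>0[OF U(2)] \<phi>[of x] \<rho>(1) by simp
  have "v \<in> complex_tangent M y"
    if "y \<in> ball x \<rho>" "y \<in> M" "v \<in> tangent_space M y" "blinfun_apply (\<omega>0 y) v = 0" for y v
  proof -
    have "y \<in> U" using that(1) \<rho>(2) by auto
    then show ?thesis using that \<omega>0[of y v] \<phi>[OF that(1)] H by simp
  qed
  moreover have "\<forall>\<^sub>F y in nhds x. y \<in> ball x \<rho>"
    using \<rho>(1) by (intro eventually_nhds_in_open) auto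
  ultimately have "coorients \<omega>0 x"
    unfolding coorients_def using contact0 by (auto elim: eventually_mono)
  moreover define z where "z = (1 / blinfun_apply (\<omega>0 x) v) *\<^sub>R v"
  moreover have "z \<in> tangent_space M x"
    unfolding z_def using subspace_scale[OF subspace_tangent_space[OF x] v] .
  moreover have "blinfun_apply (\<omega>0 x) z = 1" using nz by (simp add: z_def blinfun.scaleR_right)
  ultimately show ?thesis using that by blast
qed

lemma coorients_contact_form: "coorients \<omega> x \<Longrightarrow> contact_form M \<omega>"
  by (simp add: coorients_def)

lemma coorients_CH:
  assumes "coorients \<omega> x" "x \<in> M" "Z \<in> CT M x"
  shows "pair_CT (\<omega> x) Z = 0 \<longleftrightarrow> Z \<in> CH M x"
proof
  have "v \<in> complex_tangent M x" if "v \<in> tangent_space M x" "blinfun_apply (\<omega> x) v = 0" for v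
    using assms(1,2) that eventually_nhds_x_imp_x unfolding coorients_def by blast
  then show "pair_CT (\<omega> x) Z = 0 \<Longrightarrow> Z \<in> CH M x"
    using assms(3) by (simp add: CT_iff CH_iff pair_CT_def complex_eq_iff)
qed (use assms contact_form_CH coorients_def in blast)

text \<open>The tangent space modulo the complex tangent space is a line, so any two contact forms are
  proportional.\<close>

lemma contact_forms_proportional:
  assumes \<omega>: "coorients \<omega> x" and \<theta>: "contact_form M \<theta>" and x: "x \<in> M"
    and Z: "Z \<in> CT M x" "Z' \<in> CT M x"
  shows "pair_CT (\<theta> x) Z * pair_CT (\<omega> x) Z' = pair_CT (\<theta> x) Z' * pair_CT (\<omega> x) Z"
proof -
  let ?Y = "cscale (pair_CT (\<omega> x) Z') Z - cscale (pair_CT (\<omega> x) Z) Z'"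
  have "?Y \<in> CT M x"
    using cplx_subspace_CT[OF x] Z by (intro cplx.subspace_diff cplx.subspace_scale)
  moreover have "pair_CT (\<omega> x) ?Y = 0" by (simp add: pair_CT_simps)
  ultimately have "?Y \<in> CH M x" using coorients_CH[OF \<omega> x] by blast
  from contact_form_CH[OF \<theta> x this] show ?thesis by (simp add: pair_CT_simps mult.commute)
qed


section \<open>Pairing contact forms with brackets\<close>

text \<open>Differentiate the identity \<open>\<theta>(Y) = 0\<close>, valid along \<open>M\<close>.\<close>

lemma pair_CT_mderiv:
  assumes x: "x \<in> M" and \<theta>: "contact_form M \<theta>" and \<Theta>: "smooth_ext M x \<theta> U \<Theta>"
    and Y: "local_section M x (CH M) Y" and u: "u \<in> tangent_space M x"
  shows "pair_CT (\<theta> x) (mderiv M Y x u) = - pair_CT (frechet_derivative \<Theta> (at x) u) (Y x)"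
proof -
  have Y': "smooth_near M x Y" "\<forall>\<^sub>F y in nhds x. y \<in> U \<and> (y \<in> M \<longrightarrow> Y y \<in> CH M y)"
    using Y eventually_conj[OF smooth_ext_nhd[OF \<Theta>]] by (auto simp: local_section_iff)
  obtain V F where F: "smooth_ext M x Y V F"
    and V: "\<And>y. y \<in> V \<Longrightarrow> y \<in> U \<and> (y \<in> M \<longrightarrow> Y y \<in> CH M y)"
    using smooth_nearE[OF Y'] by blast
  have \<Theta>V: "smooth_ext M x \<theta> V \<Theta>"
    using smooth_ext_subset[OF \<Theta>] smooth_extD[OF F] V by auto
  have "pair_CT (\<Theta> y) (F y) = 0" if y: "y \<in> M" "y \<in> V" for y
    using contact_form_CH[OF \<theta> y(1), of "Y y"] V[OF y(2)] y
      smooth_extD(4)[OF \<Theta>V y] smooth_extD(4)[OF F y] by simp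
  then have E: "smooth_ext M x (\<lambda>_. 0) V (\<lambda>y. pair_CT (\<Theta> y) (F y))"
    using smooth_ext_bilinear[OF bounded_bilinear_pair_CT \<Theta>V F] by (simp add: smooth_ext_def)
  have D: "((\<lambda>y. pair_CT (\<Theta> y) (F y)) has_derivative (\<lambda>u. pair_CT (\<Theta> x) (frechet_derivative F (at x) u)
      + pair_CT (frechet_derivative \<Theta> (at x) u) (F x))) (at x)"
    using smooth_extD[OF \<Theta>V] smooth_extD[OF F]
    by (intro bounded_bilinear.FDERIV[OF bounded_bilinear_pair_CT] smooth_on_has_derivative)
  have "pair_CT (\<Theta> x) (frechet_derivative F (at x) u) + pair_CT (frechet_derivative \<Theta> (at x) u) (F x) = 0"
    using mderiv_eq[OF E u] mderiv_const[OF u, of "0::complex"]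
    unfolding frechet_derivative_at[OF D, symmetric] by simp
  then show ?thesis
    using smooth_extD(2,4)[OF \<Theta>V] smooth_extD(2,4)[OF F] x
    by (simp add: mderiv_eq[OF F u] eq_neg_iff_add_eq_0)
qed

text \<open>Cartan's formula for fields annihilated by \<open>\<theta>\<close>. It makes the pairing with a bracket
  a tensor.\<close>

lemma pair_bracket_eq:
  assumes x: "x \<in> M" and \<theta>: "contact_form M \<theta>" and \<Theta>: "smooth_ext M x \<theta> U \<Theta>"
    and X: "local_section M x (CH M) X" and Y: "local_section M x (CH M) Y"
  shows "pair_bracket M \<theta> X Y x = bracket_form \<Theta> x (X x) (Y x)"
proof -
  have T: "fst (X x) \<in> tangent_space M x" "snd (X x) \<in> tangent_space M x"
    "fst (Y x) \<in> tangent_space M x" "snd (Y x) \<in> tangent_space M x"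
    using local_section_at[OF X x] local_section_at[OF Y x] complex_tangent_subset
    by (auto simp: CH_iff)
  note D = pair_CT_mderiv[OF x \<theta> \<Theta>]
  show ?thesis
    by (simp add: pair_bracket_def bracket_def field_deriv_def pair_CT_simps D[OF X T(3)] D[OF X T(4)]
        D[OF Y T(1)] D[OF Y T(2)] bracket_form_def pair_deriv_def)
qed

lemma pair_bracket_smooth_ext:
  assumes \<theta>: "contact_form M \<theta>" and \<Theta>: "smooth_ext M x \<theta> U \<Theta>"
    and X: "local_section M x (CH M) X" and Y: "local_section M x (CH M) Y"
  obtains V F G where "V \<subseteq> U" "smooth_ext M x X V F" "smooth_ext M x Y V G"
    "smooth_ext M x (pair_bracket M \<theta> X Y) V (\<lambda>y. bracket_form \<Theta> y (F y) (G y))"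
proof -
  have ev: "\<forall>\<^sub>F y in nhds x. y \<in> U \<and> local_section M y (CH M) X \<and> local_section M y (CH M) Y"
    by (intro eventually_conj smooth_ext_nhd[OF \<Theta>] local_section_eventually X Y)
  obtain V0 F0 G where F0: "smooth_ext M x X V0 F0" and G0: "smooth_ext M x Y V0 G"
    by (rule smooth_near_common_domain[of M x X Y]) (use X Y local_section_iff in blast)+
  obtain V1 where V1: "open V1" "x \<in> V1"
    "\<And>y. y \<in> V1 \<Longrightarrow> y \<in> U \<and> local_section M y (CH M) X \<and> local_section M y (CH M) Y"
    using ev by (auto simp: eventually_nhds)
  define V where "V = V0 \<inter> V1"
  have V: "open V" "x \<in> V" "V \<subseteq> V0" "V \<subseteq> V1" "V \<subseteq> U"
    using V1 smooth_extD[OF F0] by (auto simp: V_def)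
  have F: "smooth_ext M x X V F0" and G: "smooth_ext M x Y V G" and \<Theta>V: "smooth_ext M x \<theta> V \<Theta>"
    by (rule smooth_ext_subset[OF F0 V(1-3)] smooth_ext_subset[OF G0 V(1-3)]
      smooth_ext_subset[OF \<Theta> V(1,2,5)])+
  have diff: "\<Theta> differentiable (at y)" if "y \<in> V" for y
    using smooth_on_differentiable[OF smooth_extD(3)[OF \<Theta>V] that] .
  have "smooth_on V (\<lambda>y. bracket_form \<Theta> y (F0 y) (G y))"
    by (rule smooth_on_bilinear_family[where \<beta> = "bracket_form \<Theta>", OF V(1)
          bracket_form_linear(1)[OF diff] bracket_form_linear(2)[OF diff]
          smooth_on_bracket_form[OF V(1) smooth_extD(3)[OF \<Theta>V]]
          smooth_extD(3)[OF F] smooth_extD(3)[OF G]])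
  moreover have "pair_bracket M \<theta> X Y y = bracket_form \<Theta> y (F0 y) (G y)" if y: "y \<in> M" "y \<in> V" for y
  proof -
    have "pair_bracket M \<theta> X Y y = bracket_form \<Theta> y (X y) (Y y)"
      using V1(3)[of y] y V
      by (intro pair_bracket_eq[OF y(1) \<theta> smooth_ext_subset[OF \<Theta>V V(1) y(2)]]) auto
    then show ?thesis using smooth_extD(4)[OF F y] smooth_extD(4)[OF G y] by simp
  qed
  ultimately have "smooth_ext M x (pair_bracket M \<theta> X Y) V (\<lambda>y. bracket_form \<Theta> y (F0 y) (G y))"
    using V by (simp add: smooth_ext_def)
  with that V(5) F G show ?thesis by blast
qed

lemma obtain_form_extension:
  assumes "contact_form M \<theta>" "x \<in> M"
  obtains U \<Theta> where "smooth_ext M x \<theta> U \<Theta>" "\<Theta> differentiable (at x)"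
proof -
  obtain U \<Theta> where "smooth_ext M x \<theta> U \<Theta>"
    using assms by (auto simp: contact_form_def smooth_near_def)
  with that show ?thesis using smooth_on_differentiable smooth_extD(2,3) by blast
qed

lemma smooth_near_pair_bracket:
  assumes "x \<in> M" "contact_form M \<theta>" "local_section M x (CH M) X" "local_section M x (CH M) Y"
  shows "smooth_near M x (pair_bracket M \<theta> X Y)"
proof -
  obtain U \<Theta> where "smooth_ext M x \<theta> U \<Theta>"
    using obtain_form_extension[OF assms(2,1)] .
  from pair_bracket_smooth_ext[OF assms(2) this assms(3,4)] show ?thesis
    by (metis smooth_near_def)
qed

lemma mderiv_pair_bracket:
  assumes x: "x \<in> M" and \<theta>: "contact_form M \<theta>" and \<Theta>: "smooth_ext M x \<theta> U \<Theta>"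
    and X: "local_section M x (CH M) X" and Y: "local_section M x (CH M) Y"
    and u: "u \<in> tangent_space M x"
  shows "mderiv M (pair_bracket M \<theta> X Y) x u =
    bracket_form \<Theta> x (mderiv M X x u) (Y x) + bracket_form \<Theta> x (X x) (mderiv M Y x u)
    + frechet_derivative (\<lambda>y. bracket_form \<Theta> y (X x) (Y x)) (at x) u"
proof -
  obtain V F G where V: "V \<subseteq> U" and F: "smooth_ext M x X V F" and G: "smooth_ext M x Y V G"
    and E: "smooth_ext M x (pair_bracket M \<theta> X Y) V (\<lambda>y. bracket_form \<Theta> y (F y) (G y))"
    using pair_bracket_smooth_ext[OF \<theta> \<Theta> X Y] .
  note F' = smooth_extD[OF F] and G' = smooth_extD[OF G]
  have \<Theta>V: "smooth_on V \<Theta>" using smooth_on_subset[OF smooth_extD(3)[OF \<Theta>] V] .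
  have "frechet_derivative (\<lambda>y. bracket_form \<Theta> y (F y) (G y)) (at x) u =
      bracket_form \<Theta> x (frechet_derivative F (at x) u) (G x)
      + bracket_form \<Theta> x (F x) (frechet_derivative G (at x) u)
      + frechet_derivative (\<lambda>y. bracket_form \<Theta> y (F x) (G x)) (at x) u"
    by (rule frechet_derivative_bilinear_family[where \<beta> = "bracket_form \<Theta>", OF F'(1)
          bracket_form_linear(1)[OF smooth_on_differentiable[OF \<Theta>V]]
          bracket_form_linear(2)[OF smooth_on_differentiable[OF \<Theta>V]]
          smooth_on_bracket_form[OF F'(1) \<Theta>V] F'(3) G'(3) F'(2)])
  then show ?thesis
    using F'(2,4) G'(4) x by (simp add: mderiv_eq[OF E u] mderiv_eq[OF F u] mderiv_eq[OF G u])
qed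

text \<open>Conjugation maps the bracket of \<open>X\<close> and the conjugate of \<open>Y\<close> to that of the conjugate of \<open>X\<close>
  and \<open>Y\<close>; antisymmetry restores the order of the types.\<close>

lemma pair_bracket_conj_swap:
  assumes x: "x \<in> M" and \<theta>: "contact_form M \<theta>"
    and X: "local_section M x (H10 M) X" and Y: "local_section M x (H10 M) Y"
  shows "pair_bracket M \<theta> X (conj_field Y) x = - cnj (pair_bracket M \<theta> Y (conj_field X) x)"
proof -
  obtain U \<Theta> where \<Theta>: "smooth_ext M x \<theta> U \<Theta>" "\<Theta> differentiable (at x)"
    using obtain_form_extension[OF \<theta> x] .
  have "pair_bracket M \<theta> X (conj_field Y) x = bracket_form \<Theta> x (X x) (cconj (Y x))"
    "pair_bracket M \<theta> Y (conj_field X) x = bracket_form \<Theta> x (Y x) (cconj (X x))"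
    using X Y local_section_H01_conj_field local_section_H01_CH local_section_H10_CH
    by (simp_all add: pair_bracket_eq[OF x \<theta> \<Theta>(1)] conj_field_def)
  moreover have "bracket_form \<Theta> x (X x) (cconj (Y x)) = - bracket_form \<Theta> x (cconj (Y x)) (X x)"
    by (rule bracket_form_antisym)
  ultimately show ?thesis
    using bracket_form_cconj[OF \<Theta>(2), of "Y x" "cconj (X x)"] by simp
qed


section \<open>The Levi form and its kernel\<close>

lemma CQ_class_eq_iff:
  assumes x: "x \<in> M"
  shows "CQ_class M x Z = CQ_class M x Z' \<longleftrightarrow> Z - Z' \<in> CH M x"
proof
  note sub = cplx_subspace_CH[OF x]
  assume "CQ_class M x Z = CQ_class M x Z'"
  moreover have "Z \<in> CQ_class M x Z"
    using cplx.subspace_0[OF sub] by (force simp: CQ_class_def)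
  ultimately obtain Y where "Y \<in> CH M x" "Z = Z' + Y" by (auto simp: CQ_class_def)
  then show "Z - Z' \<in> CH M x" by simp
next
  note sub = cplx_subspace_CH[OF x]
  have le: "CQ_class M x A \<subseteq> CQ_class M x B" if "A - B \<in> CH M x" for A B
  proof
    fix W assume "W \<in> CQ_class M x A"
    then obtain Y where Y: "Y \<in> CH M x" "W = A + Y" by (auto simp: CQ_class_def)
    then have "W = B + ((A - B) + Y)" "(A - B) + Y \<in> CH M x"
      using cplx.subspace_add[OF sub that] by auto
    then show "W \<in> CQ_class M x B" unfolding CQ_class_def by blast
  qed
  assume Z: "Z - Z' \<in> CH M x"
  then have "Z' - Z \<in> CH M x" using cplx.subspace_neg[OF sub Z] by simp
  with Z show "CQ_class M x Z = CQ_class M x Z'" using le by blast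
qed

lemma pair_CQ_class:
  assumes "contact_form M \<theta>" "x \<in> M"
  shows "pair_CQ (\<theta> x) (CQ_class M x Z) = pair_CT (\<theta> x) Z"
proof -
  have "pair_CT (\<theta> x) (Z + Y) = pair_CT (\<theta> x) Z" if "Y \<in> CH M x" for Y
    using contact_form_CH[OF assms that] by (simp add: pair_CT_simps)
  moreover have "0 \<in> CH M x" using cplx.subspace_0[OF cplx_subspace_CH[OF assms(2)]] .
  ultimately show ?thesis
    unfolding pair_CQ_def CQ_class_def by (intro the_equality) auto
qed

lemma coorients_CQ_inj:
  assumes \<omega>: "coorients \<omega> x" and x: "x \<in> M" and "\<xi> \<in> CQ M x" "\<eta> \<in> CQ M x"
    and eq: "pair_CQ (\<omega> x) \<xi> = pair_CQ (\<omega> x) \<eta>"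
  shows "\<xi> = \<eta>"
proof -
  obtain Z Z' where Z: "\<xi> = CQ_class M x Z" "\<eta> = CQ_class M x Z'" "Z \<in> CT M x" "Z' \<in> CT M x"
    using assms(3,4) by (auto simp: CQ_def)
  have "pair_CT (\<omega> x) (Z - Z') = 0"
    using eq by (simp add: Z pair_CQ_class[OF coorients_contact_form[OF \<omega>] x] pair_CT_simps)
  then have "Z - Z' \<in> CH M x"
    using coorients_CH[OF \<omega> x] cplx.subspace_diff[OF cplx_subspace_CT[OF x] Z(3,4)] by blast
  then show ?thesis by (simp add: Z CQ_class_eq_iff[OF x])
qed

text \<open>By Cartan's formula the pairings of the class of \<open>i [X, Y]\<close> with contact forms depend only on
  the values of \<open>X\<close> and \<open>Y\<close> at \<open>x\<close>, so this class satisfies the condition that defines the Levi form.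
  It is the only one, because a coorienting form separates classes.\<close>

lemma levi_form_eq:
  assumes x: "x \<in> M" and X: "local_section M x (H10 M) X" and Y: "local_section M x (H01 M) Y"
  shows "levi_form M x (X x) (Y x) = CQ_class M x (cscale \<i> (bracket M X Y x))"
proof -
  let ?\<xi> = "CQ_class M x (cscale \<i> (bracket M X Y x))"
  let ?P = "\<lambda>\<xi>. \<xi> \<in> CQ M x \<and> (\<forall>\<theta> L2 L1. contact_form M \<theta> \<and>
        local_section M x (H10 M) L2 \<and> local_section M x (H01 M) L1 \<and> L2 x = X x \<and> L1 x = Y x \<longrightarrow>
        pair_CQ (\<theta> x) \<xi> = \<i> * pair_bracket M \<theta> L2 L1 x)"
  have "bracket M X Y x \<in> CT M x"
    using X Y local_section_H10_CH local_section_H01_CH local_section_CH_CT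
    by (intro bracket_in_CT x) auto
  then have CQ: "?\<xi> \<in> CQ M x"
    using cplx.subspace_scale[OF cplx_subspace_CT[OF x]] by (auto simp: CQ_def)
  have pair: "pair_CQ (\<theta> x) ?\<xi> = \<i> * pair_bracket M \<theta> L2 L1 x"
    if \<theta>: "contact_form M \<theta>" and L: "local_section M x (H10 M) L2" "local_section M x (H01 M) L1"
      "L2 x = X x" "L1 x = Y x" for \<theta> L2 L1
  proof -
    obtain U \<Theta> where \<Theta>: "smooth_ext M x \<theta> U \<Theta>"
      using obtain_form_extension[OF \<theta> x] .
    have "pair_bracket M \<theta> X Y x = pair_bracket M \<theta> L2 L1 x"
      using X Y L local_section_H10_CH local_section_H01_CH
      by (simp add: pair_bracket_eq[OF x \<theta> \<Theta>])
    then show ?thesis by (simp add: pair_CQ_class[OF \<theta> x] pair_CT_simps pair_bracket_def)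
  qed
  obtain \<omega> v where \<omega>: "coorients \<omega> x" using exists_coorienting_form[OF x] .
  note contact = coorients_contact_form[OF \<omega>]
  show ?thesis unfolding levi_form_def
  proof (rule the_equality)
    show "?P ?\<xi>" using CQ pair by blast
    fix \<xi> assume \<xi>: "?P \<xi>"
    then have "pair_CQ (\<omega> x) \<xi> = \<i> * pair_bracket M \<omega> X Y x"
      using contact X Y by blast
    then have "pair_CQ (\<omega> x) \<xi> = pair_CQ (\<omega> x) ?\<xi>"
      using pair[OF contact X Y refl refl] by simp
    then show "\<xi> = ?\<xi>" using coorients_CQ_inj[OF \<omega> x _ CQ] \<xi> by blast
  qed
qed

lemma pair_CQ_levi_form:
  assumes "x \<in> M" "contact_form M \<theta>" "local_section M x (H10 M) X" "local_section M x (H01 M) Y"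
  shows "pair_CQ (\<theta> x) (levi_form M x (X x) (Y x)) = \<i> * pair_bracket M \<theta> X Y x"
  using assms by (simp add: levi_form_eq pair_CQ_class pair_CT_simps pair_bracket_def)

lemma pair_CQ_zero: "contact_form M \<theta> \<Longrightarrow> x \<in> M \<Longrightarrow> pair_CQ (\<theta> x) (CQ_zero M x) = 0"
  by (simp add: pair_CQ_class pair_CT_simps)

lemma levi_form_zero_iff:
  assumes x: "x \<in> M" and X: "local_section M x (H10 M) X" and Y: "local_section M x (H01 M) Y"
  shows "levi_form M x (X x) (Y x) = CQ_zero M x \<longleftrightarrow>
    (\<forall>\<theta>. contact_form M \<theta> \<longrightarrow> pair_bracket M \<theta> X Y x = 0)"
proof
  assume "levi_form M x (X x) (Y x) = CQ_zero M x"
  then show "\<forall>\<theta>. contact_form M \<theta> \<longrightarrow> pair_bracket M \<theta> X Y x = 0"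
    using pair_CQ_levi_form[OF x _ X Y] pair_CQ_zero[OF _ x] by fastforce
next
  assume *: "\<forall>\<theta>. contact_form M \<theta> \<longrightarrow> pair_bracket M \<theta> X Y x = 0"
  obtain \<omega> v where \<omega>: "coorients \<omega> x" using exists_coorienting_form[OF x] .
  note contact = coorients_contact_form[OF \<omega>]
  have "bracket M X Y x \<in> CT M x"
    using X Y local_section_H10_CH local_section_H01_CH local_section_CH_CT
    by (intro bracket_in_CT x) auto
  moreover have "pair_CT (\<omega> x) (bracket M X Y x) = 0"
    using * contact by (simp add: pair_bracket_def)
  ultimately have "bracket M X Y x \<in> CH M x" using coorients_CH[OF \<omega> x] by blast
  then show "levi_form M x (X x) (Y x) = CQ_zero M x"
    using cplx.subspace_scale[OF cplx_subspace_CH[OF x]]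
    by (simp add: levi_form_eq[OF x X Y] CQ_class_eq_iff[OF x])
qed

lemma K10_iff:
  assumes x: "x \<in> M" and X: "local_section M x (H10 M) X"
  shows "X x \<in> K10 M x \<longleftrightarrow> (\<forall>\<theta> Y. contact_form M \<theta> \<and> local_section M x (H10 M) Y \<longrightarrow>
    pair_bracket M \<theta> X (conj_field Y) x = 0)"
proof -
  have zero: "levi_form M x (X x) (cconj (Y x)) = CQ_zero M x \<longleftrightarrow>
      (\<forall>\<theta>. contact_form M \<theta> \<longrightarrow> pair_bracket M \<theta> X (conj_field Y) x = 0)"
    if "local_section M x (H10 M) Y" for Y
    using levi_form_zero_iff[OF x X local_section_H01_conj_field[OF that]]
    by (simp add: conj_field_def)
  show ?thesis
  proof
    assume "X x \<in> K10 M x"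
    then show "\<forall>\<theta> Y. contact_form M \<theta> \<and> local_section M x (H10 M) Y \<longrightarrow>
        pair_bracket M \<theta> X (conj_field Y) x = 0"
      using zero local_section_at[OF _ x] unfolding K10_def by blast
  next
    assume *: "\<forall>\<theta> Y. contact_form M \<theta> \<and> local_section M x (H10 M) Y \<longrightarrow>
        pair_bracket M \<theta> X (conj_field Y) x = 0"
    have "levi_form M x (X x) (cconj u) = CQ_zero M x" if u: "u \<in> H10 M x" for u
    proof -
      obtain Y where "local_section M x (H10 M) Y" "Y x = u" using H10_section_through[OF x u] .
      then show ?thesis using zero * by blast
    qed
    then show "X x \<in> K10 M x" using local_section_at[OF X x] by (simp add: K10_def)
  qed
qed

text \<open>The Levi form is Hermitian, and on these arguments it differs from the form used here by a factor
  \<open>i\<close> only. So the kernels in the two arguments are conjugate to each other.\<close>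

lemma K10_bracket_form:
  assumes x: "x \<in> M" and \<theta>: "contact_form M \<theta>" and \<Theta>: "smooth_ext M x \<theta> U \<Theta>"
    and k: "k \<in> K10 M x" and h: "h \<in> H10 M x"
  shows "bracket_form \<Theta> x k (cconj h) = 0" "bracket_form \<Theta> x h (cconj k) = 0"
proof -
  have "k \<in> H10 M x" using k by (simp add: K10_def)
  then obtain X where X: "local_section M x (H10 M) X" "X x = k" by (rule H10_section_through[OF x])
  obtain Y where Y: "local_section M x (H10 M) Y" "Y x = h" using H10_section_through[OF x h] .
  have eq: "pair_bracket M \<theta> A (conj_field B) x = bracket_form \<Theta> x (A x) (cconj (B x))"
    if "local_section M x (H10 M) A" "local_section M x (H10 M) B" for A B
    using that local_section_H01_conj_field local_section_H01_CH local_section_H10_CH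
    by (simp add: pair_bracket_eq[OF x \<theta> \<Theta>] conj_field_def)
  have "pair_bracket M \<theta> X (conj_field Y) x = 0"
    using K10_iff[OF x X(1)] X(2) k \<theta> Y(1) by blast
  then show "bracket_form \<Theta> x k (cconj h) = 0" "bracket_form \<Theta> x h (cconj k) = 0"
    using eq[OF X(1) Y(1)] eq[OF Y(1) X(1)] pair_bracket_conj_swap[OF x \<theta> Y(1) X(1)] X(2) Y(2)
    by auto
qed

lemma bracket_form_K10:
  assumes x: "x \<in> M" and k: "k \<in> H10 M x"
    and zero: "\<And>\<theta> U \<Theta> h. contact_form M \<theta> \<Longrightarrow> smooth_ext M x \<theta> U \<Theta> \<Longrightarrow> h \<in> H10 M x \<Longrightarrow>
      bracket_form \<Theta> x k (cconj h) = 0"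
  shows "k \<in> K10 M x"
proof -
  obtain X where X: "local_section M x (H10 M) X" "X x = k" using H10_section_through[OF x k] .
  have "pair_bracket M \<theta> X (conj_field Y) x = 0"
    if \<theta>: "contact_form M \<theta>" and Y: "local_section M x (H10 M) Y" for \<theta> Y
  proof -
    obtain U \<Theta> where \<Theta>: "smooth_ext M x \<theta> U \<Theta>" using obtain_form_extension[OF \<theta> x] .
    have "pair_bracket M \<theta> X (conj_field Y) x = bracket_form \<Theta> x (X x) (cconj (Y x))"
      using X(1) Y local_section_H01_conj_field local_section_H01_CH local_section_H10_CH
      by (simp add: pair_bracket_eq[OF x \<theta> \<Theta>] conj_field_def)
    then show ?thesis using zero[OF \<theta> \<Theta> local_section_at[OF Y x]] X(2) by simp
  qed
  then show ?thesis using K10_iff[OF x X(1)] X(2) by blast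
qed

lemma cplx_subspace_K10:
  assumes x: "x \<in> M"
  shows "cplx.subspace (K10 M x)"
proof -
  note sub = cplx_subspace_H10[OF x]
  have diff: "\<Theta> differentiable (at x)" if "smooth_ext M x \<theta> U \<Theta>"
    for \<theta> U and \<Theta> :: "complex^'n \<Rightarrow> (complex^'n) \<Rightarrow>\<^sub>L real"
    using smooth_on_differentiable smooth_extD(2,3)[OF that] by blast
  show ?thesis
  proof (rule cplx.subspaceI)
    show "0 \<in> K10 M x"
      using cplx.subspace_0[OF sub] linear_0[OF bracket_form_linear(1)[OF diff]]
      by (intro bracket_form_K10[OF x]) auto
  next
    fix k k' assume k: "k \<in> K10 M x" "k' \<in> K10 M x"
    then have "k + k' \<in> H10 M x" using K10_subset_H10 cplx.subspace_add[OF sub] by blast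
    then show "k + k' \<in> K10 M x"
      using K10_bracket_form(1)[OF x _ _ k(1)] K10_bracket_form(1)[OF x _ _ k(2)]
      by (intro bracket_form_K10[OF x]) (auto simp: bracket_form_add[OF diff])
  next
    fix c k assume k: "k \<in> K10 M x"
    then have "cscale c k \<in> H10 M x" using K10_subset_H10 cplx.subspace_scale[OF sub] by blast
    then show "cscale c k \<in> K10 M x"
      using K10_bracket_form(1)[OF x _ _ k]
      by (intro bracket_form_K10[OF x]) (auto simp: bracket_form_cscale[OF diff])
  qed
qed


section \<open>The cubic tensor\<close>

text \<open>By the product rule, two choices of sections with the same values change the derivative
  of the bracket pairing by the Levi form of an element of the Levi kernel and the derivative of a
  section vanishing at the point. That derivative is again of type (1,0) or (0,1), so the
  difference is zero.\<close>

lemma mderiv_pair_bracket_cong: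
  assumes x: "x \<in> M" and \<theta>: "contact_form M \<theta>"
    and X: "local_section M x (H10 M) X" "local_section M x (H10 M) X'"
    and Y: "local_section M x (H01 M) Y" "local_section M x (H01 M) Y'"
    and eq: "X x = X' x" "Y x = Y' x" and K: "X x \<in> K10 M x" "Y x \<in> K01 M x"
    and u: "u \<in> tangent_space M x"
  shows "mderiv M (pair_bracket M \<theta> X Y) x u = mderiv M (pair_bracket M \<theta> X' Y') x u"
proof -
  obtain U \<Theta> where \<Theta>: "smooth_ext M x \<theta> U \<Theta>" and diff: "\<Theta> differentiable (at x)"
    using obtain_form_extension[OF \<theta> x] .
  have sm: "smooth_near M x X" "smooth_near M x X'" "smooth_near M x Y" "smooth_near M x Y'"
    using X Y by (auto simp: local_section_iff)
  note lin = linear_diff[OF bracket_form_linear(1)[OF diff]] linear_diff[OF bracket_form_linear(2)[OF diff]]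
  obtain k where k: "k \<in> K10 M x" "Y x = cconj k" using K(2) by (auto simp: K01_def)
  have "mderiv M X x u - mderiv M X' x u = mderiv M (\<lambda>y. X y - X' y) x u"
    using mderiv_diff[OF sm(1,2) u] by simp
  also have "\<dots> \<in> H10 M x"
    using local_section_diff[OF X cplx_subspace_H10] eq u by (intro mderiv_vanishing_H10_section x) auto
  finally have X0: "bracket_form \<Theta> x (mderiv M X x u - mderiv M X' x u) (Y x) = 0"
    unfolding k(2) by (rule K10_bracket_form(2)[OF x \<theta> \<Theta> k(1)])
  have conj: "local_section M x (H10 M) (conj_field Z)" if "local_section M x (H01 M) Z" for Z
    using that by (rule local_section_conj_field) (simp add: H01_iff)
  have "cconj (mderiv M Y x u - mderiv M Y' x u) = mderiv M (\<lambda>y. conj_field Y y - conj_field Y' y) x u"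
    using mderiv_bounded_linear[OF bounded_linear_cconj smooth_near_diff[OF sm(3,4)] u]
      mderiv_diff[OF sm(3,4) u] by (simp add: conj_field_def cconj_diff)
  also have "\<dots> \<in> H10 M x"
    using local_section_diff[OF conj[OF Y(1)] conj[OF Y(2)] cplx_subspace_H10] eq u
    by (intro mderiv_vanishing_H10_section x) (auto simp: conj_field_def)
  finally have Y0: "bracket_form \<Theta> x (X x) (mderiv M Y x u - mderiv M Y' x u) = 0"
    using K10_bracket_form(1)[OF x \<theta> \<Theta> K(1)] by (metis cconj_cconj)
  show ?thesis
    using X0 Y0 X Y local_section_H10_CH local_section_H01_CH
    by (simp add: mderiv_pair_bracket[OF x \<theta> \<Theta> _ _ u] eq lin)
qed

lemma pair_bracket_K10:
  assumes x: "x \<in> M" and \<theta>: "contact_form M \<theta>"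
    and X: "local_section M x (H10 M) X" and Y: "local_section M x (H01 M) Y" and K: "X x \<in> K10 M x"
  shows "pair_bracket M \<theta> X Y x = 0"
proof -
  obtain U \<Theta> where \<Theta>: "smooth_ext M x \<theta> U \<Theta>"
    using obtain_form_extension[OF \<theta> x] .
  have "pair_bracket M \<theta> X Y x = bracket_form \<Theta> x (X x) (cconj (cconj (Y x)))"
    using X Y local_section_H10_CH local_section_H01_CH by (simp add: pair_bracket_eq[OF x \<theta> \<Theta>])
  also have "cconj (Y x) \<in> H10 M x" using local_section_at[OF Y x] by (simp add: H01_iff)
  from K10_bracket_form(1)[OF x \<theta> \<Theta> K this]
  have "bracket_form \<Theta> x (X x) (cconj (cconj (Y x))) = 0" .
  finally show ?thesis .
qed

text \<open>On \<open>M\<close> near the point, \<open>\<theta> = f \<omega>\<close> on tangent vectors with a smooth function \<open>f\<close>, so by the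
  Leibniz rule the derivatives of the pairings are proportional wherever the pairings vanish. A
  tangent field through \<open>v\<close> expresses this relation without a quotient.\<close>

lemma mderiv_pair_bracket_proportional:
  assumes x: "x \<in> M" and \<theta>: "contact_form M \<theta>" and \<omega>: "coorients \<omega> x"
    and v: "v \<in> tangent_space M x" "blinfun_apply (\<omega> x) v = 1"
    and X: "local_section M x (H10 M) X" and Y: "local_section M x (H01 M) Y" and K: "X x \<in> K10 M x"
    and u: "u \<in> tangent_space M x"
  shows "mderiv M (pair_bracket M \<theta> X Y) x u = pair_CT (\<theta> x) (v, 0) * mderiv M (pair_bracket M \<omega> X Y) x u"
proof -
  have "(v, 0) \<in> CT M x" using v subspace_0[OF subspace_tangent_space[OF x]] by (simp add: CT_iff)
  then obtain A where A: "local_section M x (CT M) A" "A x = (v, 0)" using CT_section_through[OF x] by blast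
  have smA: "smooth_near M x A" using A by (simp add: local_section_iff)
  have contact: "contact_form M \<omega>" using coorients_contact_form[OF \<omega>] .
  let ?a = "\<lambda>y. pair_CT (\<omega> y) (A y)" and ?b = "\<lambda>y. pair_CT (\<theta> y) (A y)"
  have \<omega>': "\<forall>\<^sub>F y in nhds x. coorients \<omega> y"
    using \<omega> unfolding coorients_def by (auto intro: eventually_conj simp: eventually_eventually)
  have XC: "local_section M x (CH M) X" and YC: "local_section M x (CH M) Y"
    using X Y local_section_H10_CH local_section_H01_CH by auto
  have "\<forall>\<^sub>F y in nhds x. y \<in> M \<longrightarrow>
      pair_bracket M \<theta> X Y y * ?a y = ?b y * pair_bracket M \<omega> X Y y"
    using \<omega>' local_section_eventually[OF A(1)] local_section_eventually[OF XC] local_section_eventually[OF YC]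
  proof eventually_elim
    case (elim y)
    show ?case
    proof
      assume y: "y \<in> M"
      have "bracket M X Y y \<in> CT M y"
        using elim local_section_CH_CT by (intro bracket_in_CT[OF y]) auto
      then show "pair_bracket M \<theta> X Y y * ?a y = ?b y * pair_bracket M \<omega> X Y y"
        using contact_forms_proportional[OF elim(1) \<theta> y] local_section_at[OF elim(2) y]
        by (simp add: pair_bracket_def)
    qed
  qed
  from mderiv_cong[OF this]
  have "mderiv M (\<lambda>y. pair_bracket M \<theta> X Y y * ?a y) x u = mderiv M (\<lambda>y. ?b y * pair_bracket M \<omega> X Y y) x u" .
  moreover have "smooth_near M x ?a" "smooth_near M x ?b"
    using smooth_near_bilinear[OF bounded_bilinear_pair_CT _ smA] contact \<theta> x
    by (auto simp: contact_form_def)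
  moreover have "smooth_near M x (pair_bracket M \<theta> X Y)" "smooth_near M x (pair_bracket M \<omega> X Y)"
    using smooth_near_pair_bracket[OF x _ XC YC] \<theta> contact by auto
  moreover have "?a x = 1" "?b x = pair_CT (\<theta> x) (v, 0)"
    using A(2) v(2) by (auto simp: pair_CT_def complex_eq_iff)
  ultimately show ?thesis
    using mderiv_bilinear[OF bounded_bilinear_mult, of M x "pair_bracket M \<theta> X Y" ?a u]
      mderiv_bilinear[OF bounded_bilinear_mult, of M x ?b "pair_bracket M \<omega> X Y" u]
      pair_bracket_K10[OF x \<theta> X Y K] pair_bracket_K10[OF x contact X Y K] x u by simp
qed

text \<open>Independence of the sections and proportionality of contact forms show that this class satisfies
  the condition defining the cubic tensor; a coorienting form excludes all others.\<close>

lemma tau3_eq: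
  assumes x: "x \<in> M" and \<omega>: "coorients \<omega> x"
    and v: "v \<in> tangent_space M x" "blinfun_apply (\<omega> x) v = 1"
    and W: "local_section M x (CT M) W"
    and X: "local_section M x (H10 M) X" and Y: "local_section M x (H01 M) Y"
    and K: "X x \<in> K10 M x" "Y x \<in> K01 M x"
  shows "tau3 M x (W x) (X x) (Y x) =
    CQ_class M x (cscale (\<i> * apply_field M W (pair_bracket M \<omega> X Y) x) (v, 0))"
proof -
  let ?\<xi> = "CQ_class M x (cscale (\<i> * apply_field M W (pair_bracket M \<omega> X Y) x) (v, 0))"
  let ?P = "\<lambda>\<xi>. \<xi> \<in> CQ M x \<and> (\<forall>\<theta> L3 L2 L1. contact_form M \<theta> \<and>
        local_section M x (CT M) L3 \<and> local_section M x (H10 M) L2 \<and> local_section M x (H01 M) L1 \<and>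
        L3 x = W x \<and> L2 x = X x \<and> L1 x = Y x \<longrightarrow>
        pair_CQ (\<theta> x) \<xi> = \<i> * apply_field M L3 (pair_bracket M \<theta> L2 L1) x)"
  have "(v, 0) \<in> CT M x" using v subspace_0[OF subspace_tangent_space[OF x]] by (simp add: CT_iff)
  then have CQ: "?\<xi> \<in> CQ M x"
    using cplx.subspace_scale[OF cplx_subspace_CT[OF x]] by (auto simp: CQ_def)
  have WT: "fst (W x) \<in> tangent_space M x" "snd (W x) \<in> tangent_space M x"
    using local_section_at[OF W x] by (auto simp: CT_iff)
  have pair: "pair_CQ (\<theta> x) ?\<xi> = \<i> * apply_field M L3 (pair_bracket M \<theta> L2 L1) x"
    if \<theta>: "contact_form M \<theta>" and L: "local_section M x (H10 M) L2" "local_section M x (H01 M) L1"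
      "L3 x = W x" "L2 x = X x" "L1 x = Y x" for \<theta> L3 L2 L1
  proof -
    have "mderiv M (pair_bracket M \<theta> L2 L1) x u =
        pair_CT (\<theta> x) (v, 0) * mderiv M (pair_bracket M \<omega> X Y) x u" if u: "u \<in> tangent_space M x" for u
      using mderiv_pair_bracket_cong[OF x \<theta> X L(1) Y L(2) L(4,5)[symmetric] K u]
        mderiv_pair_bracket_proportional[OF x \<theta> \<omega> v X Y K(1) u] by simp
    then have "apply_field M L3 (pair_bracket M \<theta> L2 L1) x =
        pair_CT (\<theta> x) (v, 0) * apply_field M W (pair_bracket M \<omega> X Y) x"
      using WT by (simp add: apply_field_def L(3) algebra_simps)
    then show ?thesis by (simp add: pair_CQ_class[OF \<theta> x] pair_CT_simps)
  qed
  note contact = coorients_contact_form[OF \<omega>]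
  show ?thesis unfolding tau3_def
  proof (rule the_equality)
    show "?P ?\<xi>" using CQ pair by blast
    fix \<xi> assume \<xi>: "?P \<xi>"
    then have "pair_CQ (\<omega> x) \<xi> = \<i> * apply_field M W (pair_bracket M \<omega> X Y) x"
      using contact W X Y by blast
    then have "pair_CQ (\<omega> x) \<xi> = pair_CQ (\<omega> x) ?\<xi>"
      using pair[OF contact X Y, of W] by simp
    then show "\<xi> = ?\<xi>" using coorients_CQ_inj[OF \<omega> x _ CQ] \<xi> by blast
  qed
qed

lemma tau3_zero_iff:
  assumes x: "x \<in> M" and W: "local_section M x (CT M) W"
    and X: "local_section M x (H10 M) X" and Y: "local_section M x (H01 M) Y"
    and K: "X x \<in> K10 M x" "Y x \<in> K01 M x"
  shows "tau3 M x (W x) (X x) (Y x) = CQ_zero M x \<longleftrightarrow>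
    (\<forall>\<theta>. contact_form M \<theta> \<longrightarrow> apply_field M W (pair_bracket M \<theta> X Y) x = 0)"
proof -
  obtain \<omega> v where \<omega>: "coorients \<omega> x" and v: "v \<in> tangent_space M x" "blinfun_apply (\<omega> x) v = 1"
    using exists_coorienting_form[OF x] .
  note contact = coorients_contact_form[OF \<omega>]
  let ?c = "\<i> * apply_field M W (pair_bracket M \<omega> X Y) x"
  have WT: "fst (W x) \<in> tangent_space M x" "snd (W x) \<in> tangent_space M x"
    using local_section_at[OF W x] by (auto simp: CT_iff)
  have "(v, 0) \<in> CT M x" using v subspace_0[OF subspace_tangent_space[OF x]] by (simp add: CT_iff)
  then have CT: "cscale ?c (v, 0) \<in> CT M x"
    using cplx.subspace_scale[OF cplx_subspace_CT[OF x]] by blast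
  have pair: "pair_CT (\<omega> x) (cscale ?c (v, 0)) = ?c"
    using v(2) by (simp add: pair_CT_simps) (simp add: pair_CT_def complex_eq_iff)
  have iff: "tau3 M x (W x) (X x) (Y x) = CQ_zero M x \<longleftrightarrow> ?c = 0"
    unfolding tau3_eq[OF x \<omega> v W X Y K] CQ_class_eq_iff[OF x] diff_zero
      coorients_CH[OF \<omega> x CT, symmetric] pair ..
  have scaled: "apply_field M W (pair_bracket M \<theta> X Y) x =
      pair_CT (\<theta> x) (v, 0) * apply_field M W (pair_bracket M \<omega> X Y) x" if \<theta>: "contact_form M \<theta>" for \<theta>
    using mderiv_pair_bracket_proportional[OF x \<theta> \<omega> v X Y K(1)] WT
    by (simp add: apply_field_def algebra_simps)
  show ?thesis unfolding iff
  proof (intro iffI allI impI)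
    fix \<theta> assume "?c = 0" and \<theta>: "contact_form M \<theta>"
    then show "apply_field M W (pair_bracket M \<theta> X Y) x = 0" using scaled[OF \<theta>] by simp
  qed (use contact in simp)
qed


end


section \<open>Complementing the Levi kernel\<close>

text \<open>If \<open>q = dim H - dim K\<close> vectors of \<open>H\<close> are independent modulo \<open>K\<close>, their span meets \<open>K\<close>
  trivially, so it is a complement of \<open>K\<close> in \<open>H\<close> by a dimension count.\<close>

lemma (in finite_dimensional_vector_space) independent_modulo_complement:
  fixes t :: "nat \<Rightarrow> 'b"
  assumes H: "subspace H" and K: "subspace K" "K \<subseteq> H" and q: "dim H - dim K = q"
    and t: "\<And>j. j < q \<Longrightarrow> t j \<in> H"
    and ind: "\<And>c j. (\<Sum>j<q. scale (c j) (t j)) \<in> K \<Longrightarrow> j < q \<Longrightarrow> c j = 0"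
    and v: "v \<in> H"
  shows "\<exists>c. v - (\<Sum>j<q. scale (c j) (t j)) \<in> K"
proof -
  have inj: "inj_on t {..<q}"
  proof (rule inj_onI, rule ccontr)
    fix i j assume ij: "i \<in> {..<q}" "j \<in> {..<q}" "t i = t j" "i \<noteq> j"
    define c where "c k = (if k = i then 1 else if k = j then - 1 else (0::'a))" for k
    have "(\<Sum>k<q. scale (c k) (t k)) = (\<Sum>k\<in>{i, j}. scale (c k) (t k))"
      using ij by (intro sum.mono_neutral_right) (auto simp: c_def)
    also have "\<dots> = 0" using ij by (simp add: c_def)
    finally have "c i = 0" using ind[of c i] ij subspace_0[OF K(1)] by simp
    then show False by (simp add: c_def)
  qed
  let ?S = "span (t ` {..<q})"
  have comb: "\<exists>c. w = (\<Sum>j<q. scale (c j) (t j))" if "w \<in> ?S" for w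
  proof -
    obtain d where "w = (\<Sum>a\<in>t ` {..<q}. scale (d a) a)"
      using \<open>w \<in> ?S\<close> by (auto simp: span_finite)
    then have "w = (\<Sum>j<q. scale (d (t j)) (t j))" by (simp add: sum.reindex[OF inj])
    then show ?thesis by (rule exI[of _ "\<lambda>j. d (t j)"])
  qed
  have "independent (t ` {..<q})"
  proof (rule independent_if_scalars_zero)
    fix d a assume d: "(\<Sum>a\<in>t ` {..<q}. scale (d a) a) = 0" "a \<in> t ` {..<q}"
    have "(\<Sum>j<q. scale (d (t j)) (t j)) \<in> K"
      using d(1) subspace_0[OF K(1)] by (simp add: sum.reindex[OF inj])
    then show "d a = 0" using ind[of "\<lambda>j. d (t j)"] d(2) by auto
  qed simp
  then have dimS: "dim ?S = q"
    by (simp add: dim_eq_card_independent card_image[OF inj])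
  have SK: "?S \<inter> K = {0}"
  proof -
    have "w = 0" if "w \<in> ?S" "w \<in> K" for w
    proof -
      obtain c where c: "w = (\<Sum>j<q. scale (c j) (t j))" using comb[OF \<open>w \<in> ?S\<close>] by blast
      then have "c j = 0" if "j < q" for j using ind[of c] \<open>w \<in> K\<close> that by simp
      then show ?thesis using c by simp
    qed
    then show ?thesis using subspace_0[OF K(1)] span_zero by blast
  qed
  let ?T = "{a + b |a b. a \<in> ?S \<and> b \<in> K}"
  have SH: "?S \<subseteq> H" using t by (intro span_minimal H) auto
  have "dim ?T + dim (?S \<inter> K) = dim ?S + dim K"
    using dim_sums_Int[OF subspace_span K(1)] by simp
  moreover have "dim (?S \<inter> K) = 0" unfolding SK by (simp add: dim_eq_0)
  ultimately have "dim ?T = q + dim K" using dimS by simp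
  then have "dim ?T \<ge> dim H" using q by simp
  moreover have "?T \<subseteq> H" using SH K(2) subspace_add[OF H] by blast
  ultimately have "?T = H"
    using subspace_dim_equal[OF subspace_sums[OF subspace_span K(1)] H] by blast
  then obtain a b where ab: "v = a + b" "a \<in> ?S" "b \<in> K" using v by blast
  obtain c where "a = (\<Sum>j<q. scale (c j) (t j))" using comb[OF ab(2)] by blast
  then show ?thesis using ab by (intro exI[of _ c]) simp
qed

text \<open>The vectors \<open>(b, 0)\<close> for \<open>b\<close> in a real basis of \<open>\<complex>\<^sup>n\<close> span its complexification.\<close>

lemma cvec_finite_dimensional:
  obtains B :: "'n::finite cvec set" where "finite_dimensional_vector_space cscale B"
proof -
  let ?S = "(\<lambda>b::complex^'n. (b, 0::complex^'n)) ` Basis"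
  have "Z \<in> cplx.span ?S" for Z :: "'n cvec"
  proof -
    let ?c = "\<lambda>b. Complex (fst Z \<bullet> b) (snd Z \<bullet> b)"
    have "(\<Sum>b\<in>Basis. cscale (?c b) (b, 0::complex^'n)) =
        (\<Sum>b\<in>Basis. (fst Z \<bullet> b) *\<^sub>R b, \<Sum>b\<in>Basis. (snd Z \<bullet> b) *\<^sub>R b)"
      by (simp add: cscale_def sum_prod)
    also have "\<dots> = Z" by (simp add: euclidean_representation)
    finally have "Z = (\<Sum>b\<in>Basis. cscale (?c b) (b, 0))" by simp
    also have "\<dots> \<in> cplx.span ?S"
      by (intro cplx.span_sum cplx.span_scale cplx.span_base) auto
    finally show ?thesis .
  qed
  then have span: "cplx.span ?S = UNIV" by blast
  obtain B where B: "B \<subseteq> ?S" "cplx.independent B" "?S \<subseteq> cplx.span B"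
    using cplx.maximal_independent_subset[of ?S] by metis
  have "cplx.span B = UNIV"
    using cplx.span_mono[OF B(3)] span by (simp add: cplx.span_span top.extremum_uniqueI)
  moreover have "finite B" using B(1) finite_surj[OF finite_Basis] by blast
  ultimately have "finite_dimensional_vector_space cscale B"
    using B(2) cplx.vector_space_axioms
    by (simp add: finite_dimensional_vector_space_def finite_dimensional_vector_space_axioms_def)
  with that show ?thesis .
qed

context hypersurface
begin

text \<open>A combination of the system that lies in the Levi kernel has zero Levi form with every member of
  the system, so by nondegeneracy the system is independent modulo the Levi kernel. The rank says
  that its size is the codimension of the kernel.\<close>

lemma levi_nondegenerate_complement:
  assumes x: "x \<in> M" and Lt: "levi_nondegenerate_system M x (levi_rank M x) Lt" and v: "v \<in> H10 M x"
  shows "\<exists>c. v - (\<Sum>j<levi_rank M x. cscale (c j) (Lt j x)) \<in> K10 M x"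
proof -
  let ?q = "levi_rank M x"
  have sec: "local_section M x (H10 M) (Lt j)" if "j < ?q" for j
    using Lt that by (simp add: levi_nondegenerate_system_def)
  have nondeg: "c j = 0" if "\<And>k \<theta>. k < ?q \<Longrightarrow> contact_form M \<theta> \<Longrightarrow>
      (\<Sum>j<?q. c j * pair_CQ (\<theta> x) (levi_form M x (Lt j x) (cconj (Lt k x)))) = 0" "j < ?q" for c j
    using Lt that unfolding levi_nondegenerate_system_def by blast
  obtain B :: "'n cvec set" where "finite_dimensional_vector_space cscale B"
    using cvec_finite_dimensional .
  then interpret fd: finite_dimensional_vector_space "cscale :: complex \<Rightarrow> 'n cvec \<Rightarrow> 'n cvec" B .
  show ?thesis
  proof (rule fd.independent_modulo_complement[OF cplx_subspace_H10[OF x] cplx_subspace_K10[OF x]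
        K10_subset_H10 _ _ _ v])
    show "cplx.dim (H10 M x) - cplx.dim (K10 M x) = ?q" by (simp add: levi_rank_def)
    show "Lt j x \<in> H10 M x" if "j < ?q" for j using local_section_at[OF sec[OF that] x] .
    fix c j assume K: "(\<Sum>j<?q. cscale (c j) (Lt j x)) \<in> K10 M x" and j: "j < ?q"
    show "c j = 0"
    proof (rule nondeg[OF _ j])
      fix k \<theta> assume k: "k < ?q" and \<theta>: "contact_form M \<theta>"
      obtain U \<Theta> where \<Theta>: "smooth_ext M x \<theta> U \<Theta>" and diff: "\<Theta> differentiable (at x)"
        using obtain_form_extension[OF \<theta> x] .
      note secC = local_section_H10_CH[OF sec] local_section_H01_CH[OF local_section_H01_conj_field[OF sec]]
      have "pair_CQ (\<theta> x) (levi_form M x (Lt j x) (cconj (Lt k x))) =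
          \<i> * bracket_form \<Theta> x (Lt j x) (cconj (Lt k x))" if "j < ?q" for j
        using pair_CQ_levi_form[OF x \<theta> sec[OF that] local_section_H01_conj_field[OF sec[OF k]]]
          pair_bracket_eq[OF x \<theta> \<Theta> secC(1)[OF that] secC(2)[OF k]] by (simp add: conj_field_def)
      then have "(\<Sum>j<?q. c j * pair_CQ (\<theta> x) (levi_form M x (Lt j x) (cconj (Lt k x)))) =
          \<i> * (\<Sum>j<?q. bracket_form \<Theta> x (cscale (c j) (Lt j x)) (cconj (Lt k x)))"
        by (simp add: bracket_form_cscale[OF diff] sum_distrib_left mult_ac)
      also have "\<dots> = \<i> * bracket_form \<Theta> x (\<Sum>j<?q. cscale (c j) (Lt j x)) (cconj (Lt k x))"
        by (simp add: linear_sum[OF bracket_form_linear(1)[OF diff]])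
      also have "\<dots> = 0"
        using K10_bracket_form(1)[OF x \<theta> \<Theta> K local_section_at[OF sec[OF k] x]] by simp
      finally show "(\<Sum>j<?q. c j * pair_CQ (\<theta> x) (levi_form M x (Lt j x) (cconj (Lt k x)))) = 0" .
    qed
  qed
qed


section \<open>The Levi kernel up to first order\<close>

context
  fixes p L
  assumes p: "p \<in> M" and L: "local_section M p (H10 M) L"
begin

lemma conj_L: "local_section M p (H01 M) (conj_field L)"
  using local_section_H01_conj_field[OF L] .

lemma in_levi_kernel_order1_imp_K10:
  assumes "in_levi_kernel_order1 M p L"
  shows "L p \<in> K10 M p"
proof -
  obtain W where "local_section M p (CT M) W"
    using CT_section_through[OF p cplx.subspace_0[OF cplx_subspace_CT[OF p]]] .
  then have "pair_bracket M \<theta> Y (conj_field L) p = 0"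
    if "contact_form M \<theta>" "local_section M p (H10 M) Y" for \<theta> Y
    using assms that unfolding in_levi_kernel_order1_def by blast
  then show ?thesis
    using K10_iff[OF p L] pair_bracket_conj_swap[OF p _ L] by simp
qed

lemma tau3_vanishes_iff:
  assumes K: "L p \<in> K10 M p"
  shows "tau3_vanishes M p L \<longleftrightarrow> (\<forall>\<theta> X W. contact_form M \<theta> \<and> local_section M p (H10 M) X \<and>
    local_section M p (CT M) W \<and> X p \<in> K10 M p \<longrightarrow>
    apply_field M W (pair_bracket M \<theta> X (conj_field L)) p = 0)"
proof -
  have Lp: "conj_field L p = cconj (L p)" by (simp add: conj_field_def)
  then have "conj_field L p \<in> K01 M p" using K by (simp add: K01_def)
  note iff = tau3_zero_iff[OF p _ _ conj_L _ this, unfolded Lp]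
  show ?thesis unfolding tau3_vanishes_def using iff by blast
qed

lemma tau3_vanishes_iff_kernel:
  assumes K: "L p \<in> K10 M p"
  shows "tau3_vanishes M p L \<longleftrightarrow> cconj (L p) \<in> tau3_kernel M p"
proof
  assume *: "tau3_vanishes M p L"
  have "tau3 M p u v (cconj (L p)) = CQ_zero M p" if u: "u \<in> CT M p" and v: "v \<in> K10 M p" for u v
  proof -
    obtain W where "local_section M p (CT M) W" "W p = u" using CT_section_through[OF p u] .
    moreover have "v \<in> H10 M p" using v K10_subset_H10 by blast
    then obtain X where "local_section M p (H10 M) X" "X p = v" by (rule H10_section_through[OF p])
    ultimately show ?thesis using * v unfolding tau3_vanishes_def by blast
  qed
  then show "cconj (L p) \<in> tau3_kernel M p" using K by (simp add: tau3_kernel_def K01_def)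
next
  assume "cconj (L p) \<in> tau3_kernel M p"
  then show "tau3_vanishes M p L"
    using local_section_at[OF _ p] unfolding tau3_vanishes_def tau3_kernel_def by blast
qed

lemma levi_orthogonal_bracket:
  assumes y: "y \<in> M" and L': "local_section M y (H10 M) L" and X: "local_section M y (H10 M) X"
    and orth: "levi_orthogonal M y L X" and \<theta>: "contact_form M \<theta>"
  shows "pair_bracket M \<theta> X (conj_field L) y = 0"
proof -
  have "pair_bracket M \<theta> L (conj_field X) y = 0"
    using levi_form_zero_iff[OF y L' local_section_H01_conj_field[OF X]] orth \<theta>
    by (simp add: levi_orthogonal_def conj_field_def)
  then show ?thesis using pair_bracket_conj_swap[OF y \<theta> X L'] by simp
qed

text \<open>Subtracting from an arbitrary (1,0) field \<open>X\<close> a combination of the given system with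
  constant coefficients yields a field whose value at \<open>p\<close> lies in the Levi kernel. The subtracted
  part contributes nothing near \<open>p\<close> by orthogonality, and the rest is controlled by the cubic
  tensor.\<close>

lemma in_levi_kernel_order1I:
  assumes K: "L p \<in> K10 M p" and van: "tau3_vanishes M p L"
    and Lt: "levi_nondegenerate_system M p (levi_rank M p) Lt"
    and U: "open U" "p \<in> U" "\<And>y j. y \<in> M \<inter> U \<Longrightarrow> j < levi_rank M p \<Longrightarrow> levi_orthogonal M y L (Lt j)"
  shows "in_levi_kernel_order1 M p L"
  unfolding in_levi_kernel_order1_def
proof (intro allI impI, elim conjE, rule conjI)
  fix \<theta> X W
  assume \<theta>: "contact_form M \<theta>" and X: "local_section M p (H10 M) X" and W: "local_section M p (CT M) W"
  let ?q = "levi_rank M p"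
  show "pair_bracket M \<theta> X (conj_field L) p = 0"
    using K10_iff[OF p L] K \<theta> X pair_bracket_conj_swap[OF p \<theta> X L] by simp
  obtain c where c: "X p - (\<Sum>j<?q. cscale (c j) (Lt j p)) \<in> K10 M p"
    using levi_nondegenerate_complement[OF p Lt local_section_at[OF X p]] by blast
  have sec: "local_section M p (H10 M) (Lt j)" if "j < ?q" for j
    using Lt that by (simp add: levi_nondegenerate_system_def)
  define X' where "X' y = X y - (\<Sum>j<?q. cscale (c j) (Lt j y))" for y
  have X': "local_section M p (H10 M) X'" unfolding X'_def
    using cplx_subspace_H10 sec
    by (intro local_section_diff[OF X] local_section_sum local_section_cscale) auto
  have ev: "\<forall>\<^sub>F y in nhds p. \<forall>j\<in>{..<?q}. local_section M y (H10 M) (Lt j)"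
    using sec local_section_eventually by (intro eventually_ball_finite) auto
  have "\<forall>\<^sub>F y in nhds p. y \<in> M \<longrightarrow>
      pair_bracket M \<theta> X (conj_field L) y = pair_bracket M \<theta> X' (conj_field L) y"
    using ev local_section_eventually[OF X] local_section_eventually[OF X']
      local_section_eventually[OF L] eventually_nhds_in_open[OF U(1,2)]
  proof eventually_elim
    case (elim y)
    show ?case
    proof
      assume y: "y \<in> M"
      obtain V \<Theta> where \<Theta>: "smooth_ext M y \<theta> V \<Theta>" and diff: "\<Theta> differentiable (at y)"
        using obtain_form_extension[OF \<theta> y] .
      have eq: "pair_bracket M \<theta> Z (conj_field L) y = bracket_form \<Theta> y (Z y) (cconj (L y))"
        if "local_section M y (H10 M) Z" for Z
        using that elim(4) local_section_H01_conj_field local_section_H01_CH local_section_H10_CH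
        by (simp add: pair_bracket_eq[OF y \<theta> \<Theta>] conj_field_def)
      have "bracket_form \<Theta> y (Lt j y) (cconj (L y)) = 0" if j: "j < ?q" for j
      proof -
        have "local_section M y (H10 M) (Lt j)" using elim(1) j by blast
        then show ?thesis
          using levi_orthogonal_bracket[OF y elim(4) _ U(3) \<theta>] eq[of "Lt j"] y elim(5) j by simp
      qed
      then have "bracket_form \<Theta> y (\<Sum>j<?q. cscale (c j) (Lt j y)) (cconj (L y)) = 0"
        by (simp add: linear_sum[OF bracket_form_linear(1)[OF diff]] bracket_form_cscale[OF diff])
      then show "pair_bracket M \<theta> X (conj_field L) y = pair_bracket M \<theta> X' (conj_field L) y"
        using eq[OF elim(2)] eq[OF elim(3)]
        by (simp add: X'_def linear_diff[OF bracket_form_linear(1)[OF diff]])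
    qed
  qed
  then have "apply_field M W (pair_bracket M \<theta> X (conj_field L)) p =
      apply_field M W (pair_bracket M \<theta> X' (conj_field L)) p"
    by (simp add: apply_field_def mderiv_cong)
  also have "\<dots> = 0"
    using tau3_vanishes_iff[OF K] van \<theta> X' W c by (auto simp: X'_def)
  finally show "apply_field M W (pair_bracket M \<theta> X (conj_field L)) p = 0" .
qed

end

end

theorem lemma4p6:
  fixes M :: "(complex^'n) set" and p :: "complex^'n" and q :: nat
    and L :: "complex^'n \<Rightarrow> 'n cvec"
  assumes "real_hypersurface M" and "p \<in> M" and "levi_rank M p = q"
    and "local_section M p (H10 M) L"
  shows "(in_levi_kernel_order1 M p L \<longrightarrow> L p \<in> K10 M p \<and> tau3_vanishes M p L) \<and>
    (L p \<in> K10 M p \<longrightarrow> (tau3_vanishes M p L \<longleftrightarrow> cconj (L p) \<in> tau3_kernel M p)) \<and>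
    (\<forall>Lt :: nat \<Rightarrow> complex^'n \<Rightarrow> 'n cvec.
       L p \<in> K10 M p \<and> tau3_vanishes M p L \<and> levi_nondegenerate_system M p q Lt \<and>
       (\<exists>U. open U \<and> p \<in> U \<and> (\<forall>x\<in>M \<inter> U. \<forall>j<q. levi_orthogonal M x L (Lt j))) \<longrightarrow>
       in_levi_kernel_order1 M p L)"
proof (intro conjI impI allI)
  interpret hypersurface M by unfold_locales (rule assms(1))
  note p = assms(2) and L = assms(4)
  {
    assume *: "in_levi_kernel_order1 M p L"
    show K: "L p \<in> K10 M p" using in_levi_kernel_order1_imp_K10[OF p L *] .
    show "tau3_vanishes M p L"
      unfolding tau3_vanishes_iff[OF p L K] using * unfolding in_levi_kernel_order1_def by blast
  next
    assume "L p \<in> K10 M p"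
    then show "tau3_vanishes M p L \<longleftrightarrow> cconj (L p) \<in> tau3_kernel M p"
      by (rule tau3_vanishes_iff_kernel[OF p L])
  next
    fix Lt :: "nat \<Rightarrow> complex^'n \<Rightarrow> 'n cvec"
    assume "L p \<in> K10 M p \<and> tau3_vanishes M p L \<and> levi_nondegenerate_system M p q Lt \<and>
       (\<exists>U. open U \<and> p \<in> U \<and> (\<forall>x\<in>M \<inter> U. \<forall>j<q. levi_orthogonal M x L (Lt j)))"
    then show "in_levi_kernel_order1 M p L"
      using in_levi_kernel_order1I[OF p L] assms(3) by blast
  }
qed

end
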